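(* Suppose markets $\mathcal M,\widetilde{\mathcal M}$ are identical except that $\widetilde{\mathcal M}$ has a reduced search cost $\tilde c<c$. Then there is a coupling between their histories $H^{\mathcal M}$ and $H^{\widetilde{\mathcal M}}$ such that the following holds almost surely over this coupling: (1) $S^{\mathrm{lnd}}(\widetilde{\mathcal M})\supseteq S^{\mathrm{lnd}}(\mathcal M)$, i.e. every business learned under $H^{\mathcal M}$ is learned under $H^{\widetilde{\mathcal M}}$; (2) $U(\widetilde{\mathcal M})\ge U(\mathcal M)$, i.e. the limit consumer utility is weakly higher under $H^{\widetilde{\mathcal M}}$ than under $H^{\mathcal M}$.
   Context: A market $\mathcal M$ consists of: $m$ businesses $j\in[m]$ with parameters $\pi_j\in(0,1)$ (fit probability) and $Q_j\in[0,1]$ (quality); fixed known prices $P_j\ge 0$; a value distribution $\mathcal D^V$ on $[0,\infty)$ that is regular (with CDF $\Psi$ and density $\psi$, $v-(1-\Psi(v))/\psi(v)$ is non-decreasing), has a density, and has bounded support with maximum $\overline V$; a common prior $\mathcal P=(\mathcal P^F_j,\mathcal P^Q_j)_{j\in[m]}$ under which all $\pi_j\sim\mathcal P^F_j$, $Q_j\sim\mathcal P^Q_j$ are independent; and a search cost $c\ge 0$. The parameters $(\pi_j,Q_j)_j$ are fixed and are a potential realization of the prior (lie in its support). Consumers know everything except $(\pi_j,Q_j)_j$. Dynamics: in round $i=1,2,\dots$ consumer $i$ arrives with value $V_i\sim\mathcal D^V$ (i.i.d., privately known). For each $j$, fit $F_{ij}\sim\mathrm{Bernoulli}(\pi_j)$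 and quality realization $q_{ij}\sim\mathrm{Bernoulli}(Q_j)$, all independent. The consumer sequentially and adaptively inspects businesses, paying $c$ per inspection to observe $F_{ij}$; she may stop at any time and transact with at most one inspected business. Transacting with $j$ yields expected transaction utility $V_iQ_jF_{ij}-P_j$ given $F_{ij}$; total utility is transaction utility minus total search cost. After round $i$, the history records the inspected businesses with their $F_{ij}$, and the business transacted with (if any) with its $q_{ij}$. $H^{\mathcal M}_n$ is the history of the first $n$ rounds ($H^{\mathcal M}$ the infinite one); consumer $i$ sees $H^{\mathcal M}_{i-1}$. Beliefs: $\mathcal P^F_{ij},\mathcal P^Q_{ij}$ are the Bayesian posteriors of $\pi_j,Q_j$ given $H^{\mathcal M}_{i-1}$, with means $\hat\pi_{ij},\hat Q_{ij}$. Consumers maximize expected utility given these beliefs: with index $\sigma_{ij}=V_i\hat Q_{ij}-P_j-c/\hat\pi_{ij}$, consumer $i$ inspects the businesses with $\sigma_{ij}>0$ in decreasing order of index and transacts with the first inspected $j$ with $F_{ij}=1$ (if any), then leaves. Business $j$ is learned (for a realization of $H^{\mathcal M}$) if $(\mathcal P^F_{ij},\mathcal P^Q_{ij})\to(\pi_j,Q_j)$ in probability as $i\to\infty$ (posteriors concentrate at the true values). $S^{\mathrm{lnd}}(\mathcal M)$ is the (random) set of learned businesses. For $S\subseteq[m]$, $U^*(S)$ is the optimal expected total utility of a consumer with value drawn from $\mathcal D^V$ who knows $(\pi_j,Q_j)$ for $j\in S$ exactly and may only inspect and transact with businesses in $S$. The limit consumer utility is the random variable $U(\mathcal M):=U^*(S^{\mathrm{lnd}}(\mathcal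 M))$. A coupling of two random objects is a joint distribution with the correct marginals. *)

theory Defs
  imports "HOL-Probability.Probability"
begin

text \<open>
  One round is recorded as a pair: the first component maps each inspected business to its
  observed fit (and every other business to \<^term>\<open>None\<close>); the second is the business
  transacted with, if any, together with its quality realization.
  Finite histories are lists with the \<^emph>\<open>most recent\<close> round first.
\<close>

type_synonym 'b obs = "('b \<Rightarrow> bool option) \<times> ('b \<times> bool) option"
type_synonym 'b hist = "'b obs list"

text \<open>
  The businesses are the elements of a finite type \<open>'b\<close> (so $m$ is the cardinality of \<open>'b\<close>).
  The inspection order is by decreasing index, which leaves open what happens when two
  indices coincide. This is settled by \<open>tie_rank\<close>: among businesses with equal index,
  the one of smaller rank is inspected first. The ranks are arbitrary and may depend on the
  public history and on the value of the arriving consumer.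
\<close>

record 'b market =
  fit_prob :: "'b \<Rightarrow> real"
  quality :: "'b \<Rightarrow> real"
  price :: "'b \<Rightarrow> real"
  val_dist :: "real measure"
  prior_fit :: "'b \<Rightarrow> real measure"
  prior_qual :: "'b \<Rightarrow> real measure"
  search_cost :: real
  tie_rank :: "'b hist \<Rightarrow> real \<Rightarrow> 'b \<Rightarrow> nat"

definition msupport :: "real measure \<Rightarrow> real set" where
  "msupport \<mu> = {x. \<forall>A. open A \<longrightarrow> x \<in> A \<longrightarrow> 0 < emeasure \<mu> A}"

text \<open>
  Regularity compares virtual values only where the density is positive: elsewhere the
  quotient is undefined mathematically, while \<^term>\<open>x / 0 = (0::real)\<close> in HOL.
\<close>

definition regular_density :: "real measure \<Rightarrow> (real \<Rightarrow> real) \<Rightarrow> bool" where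
  "regular_density D \<psi> \<longleftrightarrow>
     \<psi> \<in> borel_measurable borel \<and> (\<forall>v. 0 \<le> \<psi> v) \<and>
     D = density lborel (\<lambda>v. ennreal (\<psi> v)) \<and>
     mono_on {v. 0 < \<psi> v} (\<lambda>v. v - (1 - cdf D v) / \<psi> v)"

definition value_distribution :: "real measure \<Rightarrow> bool" where
  "value_distribution D \<longleftrightarrow>
     real_distribution D \<and> (AE v in D. 0 \<le> v) \<and>
     (\<exists>\<psi>. regular_density D \<psi>) \<and>
     (\<exists>vmax \<in> msupport D. \<forall>v \<in> msupport D. v \<le> vmax)"

definition valid_market :: "('b::finite) market \<Rightarrow> bool" where
  "valid_market M \<longleftrightarrow>
     value_distribution (val_dist M) \<and>
     0 \<le> search_cost M \<and>
     (\<forall>j. 0 < fit_prob M j \<and> fit_prob M j < 1) \<and>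
     (\<forall>j. 0 \<le> quality M j \<and> quality M j \<le> 1) \<and>
     (\<forall>j. 0 \<le> price M j) \<and>
     (\<forall>j. real_distribution (prior_fit M j) \<and> (AE x in prior_fit M j. 0 < x \<and> x < 1)) \<and>
     (\<forall>j. real_distribution (prior_qual M j) \<and> (AE x in prior_qual M j. 0 \<le> x \<and> x \<le> 1)) \<and>
     (\<forall>j. fit_prob M j \<in> msupport (prior_fit M j)) \<and>
     (\<forall>j. quality M j \<in> msupport (prior_qual M j)) \<and>
     (\<forall>h v. inj (tie_rank M h v)) \<and>
     (\<forall>h j. (\<lambda>v. tie_rank M h v j) \<in> borel \<rightarrow>\<^sub>M count_space UNIV)"

text \<open>A parameter is a pair (fit probabilities, qualities).\<close>

type_synonym 'b param = "('b \<Rightarrow> real) \<times> ('b \<Rightarrow> real)"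

definition true_param :: "'b market \<Rightarrow> 'b param" where
  "true_param M = (fit_prob M, quality M)"

definition prior :: "('b::finite) market \<Rightarrow> 'b param measure" where
  "prior M = (\<Pi>\<^sub>M j\<in>UNIV. prior_fit M j) \<Otimes>\<^sub>M (\<Pi>\<^sub>M j\<in>UNIV. prior_qual M j)"

text \<open>
  The randomness of one round: the consumer's value and, for every business, the pair
  (fit, quality realization). Only the part revealed by the consumer's behaviour is recorded.
\<close>

type_synonym 'b shock = "real \<times> ('b \<Rightarrow> bool \<times> bool)"

definition shock_dist :: "('b::finite) market \<Rightarrow> 'b param \<Rightarrow> 'b shock measure" where
  "shock_dist M \<theta> = val_dist M \<Otimes>\<^sub>M
     measure_pmf (Pi_pmf UNIV (False, False)
       (\<lambda>j. pair_pmf (bernoulli_pmf (fst \<theta> j)) (bernoulli_pmf (snd \<theta> j))))"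

definition index :: "'b market \<Rightarrow> 'b param measure \<Rightarrow> real \<Rightarrow> 'b \<Rightarrow> real" where
  "index M B v j =
     v * (\<integral>\<theta>. snd \<theta> j \<partial>B) - price M j - search_cost M / (\<integral>\<theta>. fst \<theta> j \<partial>B)"

definition precedes :: "('b \<Rightarrow> real) \<Rightarrow> ('b \<Rightarrow> nat) \<Rightarrow> 'b \<Rightarrow> 'b \<Rightarrow> bool" where
  "precedes \<sigma> r k j \<longleftrightarrow> \<sigma> j < \<sigma> k \<or> \<sigma> k = \<sigma> j \<and> r k < r j"

text \<open>
  The consumer goes through the businesses of positive index in the above order until she
  meets the first fit; hence she reaches \<open>j\<close> iff none of the preceding ones fits.
\<close>

definition inspects :: "('b \<Rightarrow> real) \<Rightarrow> ('b \<Rightarrow> nat) \<Rightarrow> ('b \<Rightarrow> bool) \<Rightarrow> 'b \<Rightarrow> bool" where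
  "inspects \<sigma> r F j \<longleftrightarrow> 0 < \<sigma> j \<and> (\<forall>k. 0 < \<sigma> k \<and> precedes \<sigma> r k j \<longrightarrow> \<not> F k)"

definition observe :: "('b \<Rightarrow> real) \<Rightarrow> ('b \<Rightarrow> nat) \<Rightarrow> ('b \<Rightarrow> bool \<times> bool) \<Rightarrow> 'b obs" where
  "observe \<sigma> r w =
     (let F = fst \<circ> w in
       (\<lambda>j. if inspects \<sigma> r F j then Some (F j) else None,
        if \<exists>j. inspects \<sigma> r F j \<and> F j
        then (let j = (THE j. inspects \<sigma> r F j \<and> F j) in Some (j, snd (w j)))
        else None))"

definition round_obs :: "'b market \<Rightarrow> 'b hist \<Rightarrow> 'b param measure \<Rightarrow> 'b shock \<Rightarrow> 'b obs" where
  "round_obs M h B s = observe (index M B (fst s)) (tie_rank M h (fst s)) (snd s)"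

text \<open>
  Bayes' rule. The likelihood \<open>lik M h \<theta>\<close> is the probability of the finite history \<open>h\<close>
  under parameter \<open>\<theta>\<close>, all consumers behaving according to the model. The behaviour in each
  round depends on the posterior given the preceding rounds, whence the recursion through
  \<open>bayes\<close>.
\<close>

definition bayes :: "('b::finite) market \<Rightarrow> ('b param \<Rightarrow> ennreal) \<Rightarrow> 'b param measure" where
  "bayes M L = density (prior M) (\<lambda>\<theta>. L \<theta> / (\<integral>\<^sup>+\<theta>'. L \<theta>' \<partial>prior M))"

primrec lik :: "('b::finite) market \<Rightarrow> 'b hist \<Rightarrow> 'b param \<Rightarrow> ennreal" where
  "lik M [] = (\<lambda>\<theta>. 1)"
| "lik M (x # h) = (\<lambda>\<theta>. lik M h \<theta> *
     emeasure (shock_dist M \<theta>)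
       {s \<in> space (shock_dist M \<theta>). round_obs M h (bayes M (lik M h)) s = x})"

definition posterior :: "('b::finite) market \<Rightarrow> 'b hist \<Rightarrow> 'b param measure" where
  "posterior M h = bayes M (lik M h)"

definition post_fit :: "('b::finite) market \<Rightarrow> 'b hist \<Rightarrow> 'b \<Rightarrow> real measure" where
  "post_fit M h j = distr (posterior M h) borel (\<lambda>\<theta>. fst \<theta> j)"

definition post_qual :: "('b::finite) market \<Rightarrow> 'b hist \<Rightarrow> 'b \<Rightarrow> real measure" where
  "post_qual M h j = distr (posterior M h) borel (\<lambda>\<theta>. snd \<theta> j)"

text \<open>
  An infinite history is a sequence of round records; \<open>past X n\<close> consists of its first
  \<open>n\<close> rounds. Rounds are numbered from 0.
\<close>

definition past :: "(nat \<Rightarrow> 'b obs) \<Rightarrow> nat \<Rightarrow> 'b hist" where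
  "past X n = rev (map X [0..<n])"

primrec run :: "('b::finite) market \<Rightarrow> (nat \<Rightarrow> 'b shock) \<Rightarrow> nat \<Rightarrow> 'b hist" where
  "run M \<omega> 0 = []"
| "run M \<omega> (Suc n) =
     round_obs M (run M \<omega> n) (posterior M (run M \<omega> n)) (\<omega> n) # run M \<omega> n"

definition history :: "('b::finite) market \<Rightarrow> (nat \<Rightarrow> 'b shock) \<Rightarrow> nat \<Rightarrow> 'b obs" where
  "history M \<omega> n = hd (run M \<omega> (Suc n))"

definition history_law :: "('b::finite) market \<Rightarrow> (nat \<Rightarrow> 'b obs) measure" where
  "history_law M =
     distr (\<Pi>\<^sub>M n\<in>UNIV. shock_dist M (true_param M)) (\<Pi>\<^sub>M n\<in>UNIV. count_space UNIV) (history M)"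

text \<open>
  Along a fixed realization the posteriors are deterministic measures, so convergence in
  probability to a constant means that the posterior mass outside every neighbourhood of
  that constant vanishes.
\<close>

definition concentrates :: "(nat \<Rightarrow> real measure) \<Rightarrow> real \<Rightarrow> bool" where
  "concentrates \<mu> a \<longleftrightarrow> (\<forall>\<epsilon>>0. (\<lambda>n. measure (\<mu> n) {x. \<epsilon> < \<bar>x - a\<bar>}) \<longlonglongrightarrow> 0)"

definition learned :: "('b::finite) market \<Rightarrow> (nat \<Rightarrow> 'b obs) \<Rightarrow> 'b set" where
  "learned M X = {j. concentrates (\<lambda>n. post_fit M (past X n) j) (fit_prob M j) \<and>
                     concentrates (\<lambda>n. post_qual M (past X n) j) (quality M j)}"

text \<open>
  Adaptive search plans: \<open>Inspect j a b\<close> inspects \<open>j\<close> and continues with \<open>a\<close> if \<open>j\<close> does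
  not fit and with \<open>b\<close> if it does. In \<open>admissible S I\<close>, \<open>I\<close> is the set of businesses inspected
  so far; in \<open>plan_util\<close>, \<open>f\<close> holds the fits observed so far (its values at businesses not
  inspected are irrelevant for admissible plans).
\<close>

datatype 'b plan = Leave | Transact 'b | Inspect 'b "'b plan" "'b plan"

primrec admissible :: "'b set \<Rightarrow> 'b plan \<Rightarrow> 'b set \<Rightarrow> bool" where
  "admissible S Leave I \<longleftrightarrow> True"
| "admissible S (Transact j) I \<longleftrightarrow> j \<in> I"
| "admissible S (Inspect j a b) I \<longleftrightarrow>
     j \<in> S - I \<and> admissible S a (insert j I) \<and> admissible S b (insert j I)"

primrec plan_util :: "'b market \<Rightarrow> real \<Rightarrow> 'b plan \<Rightarrow> ('b \<Rightarrow> bool) \<Rightarrow> real" where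
  "plan_util M v Leave f = 0"
| "plan_util M v (Transact j) f = v * quality M j * of_bool (f j) - price M j"
| "plan_util M v (Inspect j a b) f =
     (1 - fit_prob M j) * plan_util M v a (f(j := False))
     + fit_prob M j * plan_util M v b (f(j := True)) - search_cost M"

text \<open>A policy chooses a plan knowing the consumer's own value.\<close>

definition policies :: "'b set \<Rightarrow> (real \<Rightarrow> 'b plan) set" where
  "policies S = {p \<in> borel \<rightarrow>\<^sub>M count_space UNIV. \<forall>v. admissible S (p v) {}}"

definition opt_util :: "'b market \<Rightarrow> 'b set \<Rightarrow> real" where
  "opt_util M S = (SUP p\<in>policies S. \<integral>v. plan_util M v (p v) (\<lambda>_. False) \<partial>val_dist M)"

definition limit_util :: "('b::finite) market \<Rightarrow> (nat \<Rightarrow> 'b obs) \<Rightarrow> real" where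
  "limit_util M X = opt_util M (learned M X)"

definition coupling :: "('a \<times> 'c) measure \<Rightarrow> 'a measure \<Rightarrow> 'c measure \<Rightarrow> bool" where
  "coupling K A B \<longleftrightarrow> prob_space K \<and> sets K = sets (A \<Otimes>\<^sub>M B) \<and>
     distr K A fst = A \<and> distr K B snd = B"

end

theory Submission
  imports Defs
begin

text \<open>
  Since the inspection order depends on the consumers' values and the public history only, the
  likelihood of a history factorises over the individual parameters, and the posterior of
  business \<open>j\<close> is a function of what the inspections of \<open>j\<close> have revealed. Couple the two
  markets by letting the \<open>k\<close>-th inspection of \<open>j\<close> reveal the same fit and quality in both.
  If \<open>j\<close> is inspected a \<open>k\<close>-th time under the higher search cost, then its index at that
  stage is positive for a non-null set of values; this remains so under the lower cost, where
  \<open>j\<close> would be inspected with a probability bounded away from 0 in every round spent at that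
  stage. Hence almost surely \<open>j\<close> is inspected at least as often under the lower cost. As
  both markets pass through the same posteriors, and posteriors that are degenerate at the truth
  stay so, \<open>j\<close> is learned under the lower cost if it is learned under the higher one.
\<close>

section \<open>Sequential search\<close>

text \<open>The markets cannot be compared round by round: a lower cost raises the indices by
  different amounts, so the order of inspection changes, and a consumer who meets a fit earlier may
  no longer reach \<open>j\<close>. Hence only the records of a single business are compared,
  whatever the rounds in which they arise. The bound on the inspection probability comes from the
  event that no business fits, whose probability is the product of the
  \<open>1 - fit_prob M j\<close>; on it every business of positive index is reached, however the
  others rank. Posterior mass that is merely small may grow again with further observations; what is
  inherited is mass exactly 0, and a posterior that has stopped moving while converging to the truth
  has exactly that. Bayes' rule is meaningful only where the normaliser is positive. Every history
  of positive probability under the truth has this property, because likelihoods are continuous and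
  the true parameters lie in the support of the prior.\<close>

lemma precedes_irrefl: "\<not> precedes \<sigma> r j j"
  by (simp add: precedes_def)

lemma precedes_trans: "precedes \<sigma> r i j \<Longrightarrow> precedes \<sigma> r j k \<Longrightarrow> precedes \<sigma> r i k"
  unfolding precedes_def by auto

lemma precedes_total: "inj r \<Longrightarrow> i \<noteq> j \<Longrightarrow> precedes \<sigma> r i j \<or> precedes \<sigma> r j i"
  unfolding precedes_def by (metis injD linorder_neqE_nat linorder_neqE)

text \<open>On a finite type a strict order is well-founded (the number of predecessors strictly
  increases), so the fitting businesses of positive index that precede \<open>j\<close> have a
  minimal element. Nothing that fits comes before it, hence it is inspected.\<close>

lemma first_fit_inspected:
  fixes \<sigma> :: "'b::finite \<Rightarrow> real"
  assumes "0 < \<sigma> k" "F k" "precedes \<sigma> r k j"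
  obtains i where "inspects \<sigma> r F i" "F i" "0 < \<sigma> i" "precedes \<sigma> r i j"
proof -
  have "card {z. precedes \<sigma> r z x} < card {z. precedes \<sigma> r z y}" if xy: "precedes \<sigma> r x y" for x y
  proof -
    have "{z. precedes \<sigma> r z x} \<subset> {z. precedes \<sigma> r z y}"
      using xy precedes_trans[of \<sigma> r _ x y] precedes_irrefl[of \<sigma> r] by auto
    then show ?thesis by (intro psubset_card_mono) simp_all
  qed
  then have "wf {(x, y). precedes \<sigma> r x y}"
    by (intro wf_subset[OF wf_measure[of "\<lambda>x. card {z. precedes \<sigma> r z x}"]]) auto
  then obtain i where i: "0 < \<sigma> i \<and> F i \<and> precedes \<sigma> r i j"
    and min: "\<And>l. precedes \<sigma> r l i \<Longrightarrow> \<not> (0 < \<sigma> l \<and> F l \<and> precedes \<sigma> r l j)"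
    using assms wfE_min[of "{(x, y). precedes \<sigma> r x y}" k "{i. 0 < \<sigma> i \<and> F i \<and> precedes \<sigma> r i j}"]
    by (metis (mono_tags, lifting) case_prodI mem_Collect_eq)
  have "inspects \<sigma> r F i"
    unfolding inspects_def using i min precedes_trans by metis
  with i that show thesis by blast
qed

lemma transacted_unique:
  assumes "inj r" "inspects \<sigma> r F i" "F i" "inspects \<sigma> r F j" "F j"
  shows "i = j"
  using assms precedes_total[of r i j \<sigma>] unfolding inspects_def by blast

text \<open>Search stops at the first fit, so the fits of businesses never reached cannot influence
  who is reached. If a fit under \<open>F'\<close> keeps \<open>j\<close> from being inspected, the
  first such fit is itself inspected, is therefore shared by \<open>F\<close>, and blocks
  \<open>j\<close> there too.\<close>

lemma inspects_cong:
  fixes \<sigma> :: "'b::finite \<Rightarrow> real"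
  assumes "\<And>i. inspects \<sigma> r F' i \<Longrightarrow> F i = F' i"
  shows "inspects \<sigma> r F = inspects \<sigma> r F'"
proof (rule ext, rule iffI)
  fix j assume j: "inspects \<sigma> r F' j"
  have "F k = F' k" if "0 < \<sigma> k" "precedes \<sigma> r k j" for k
    using j that precedes_trans[of \<sigma> r _ k j] assms unfolding inspects_def by blast
  with j show "inspects \<sigma> r F j" unfolding inspects_def by blast
next
  fix j assume j: "inspects \<sigma> r F j"
  show "inspects \<sigma> r F' j"
  proof (rule ccontr)
    assume "\<not> inspects \<sigma> r F' j"
    with j obtain k where "0 < \<sigma> k" "F' k" "precedes \<sigma> r k j" unfolding inspects_def by blast
    then obtain i where "inspects \<sigma> r F' i" "F' i" "0 < \<sigma> i" "precedes \<sigma> r i j"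
      by (rule first_fit_inspected)
    with assms[of i] j show False unfolding inspects_def by auto
  qed
qed

text \<open>
  What a round reveals about a business: fit and quality realization, where the latter is
  set to \<^term>\<open>False\<close> when the business does not fit, since it is then not observed.
\<close>

definition reveal :: "bool \<times> bool \<Rightarrow> bool \<times> bool" where
  "reveal y = (fst y, fst y \<and> snd y)"

text \<open>The quality is read off the transaction: in a record produced by \<open>observe\<close>,
  an inspected business that fits is the one transacted with.\<close>

definition revealed :: "'b \<Rightarrow> 'b obs \<Rightarrow> (bool \<times> bool) option" where
  "revealed j x = map_option (\<lambda>f. (f, f \<and> snd x = Some (j, True))) (fst x j)"

lemma fst_observe: "fst (observe \<sigma> r w) = (\<lambda>j. if inspects \<sigma> r (fst \<circ> w) j then Some (fst (w j)) else None)"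
  by (auto simp: observe_def Let_def)

lemma snd_observe:
  assumes "inj r" "inspects \<sigma> r (fst \<circ> w) j" "fst (w j)"
  shows "snd (observe \<sigma> r w) = Some (j, snd (w j))"
proof -
  have "(THE j. inspects \<sigma> r (fst \<circ> w) j \<and> (fst \<circ> w) j) = j"
    using assms by (intro the_equality) (auto intro: transacted_unique)
  then show ?thesis using assms by (auto simp: observe_def Let_def)
qed

lemma revealed_observe:
  assumes "inj r"
  shows "revealed j (observe \<sigma> r w) =
    (if inspects \<sigma> r (fst \<circ> w) j then Some (reveal (w j)) else None)"
  using snd_observe[OF assms, of \<sigma> w j]
  by (auto simp: revealed_def fst_observe reveal_def)

text \<open>This separates the event that a round yields \<open>x\<close> into a condition on
  indices and ranks only, and one condition on the outcome of each inspected business. It is the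
  source of all product formulas below.\<close>

lemma observe_eq_iff:
  fixes \<sigma> :: "'b::finite \<Rightarrow> real"
  assumes r: "inj r"
  shows "observe \<sigma> r w = x \<longleftrightarrow>
    (\<exists>w'. observe \<sigma> r w' = x) \<and> (\<forall>j y. revealed j x = Some y \<longrightarrow> reveal (w j) = y)"
    (is "?L \<longleftrightarrow> ?R")
proof
  show "?L \<Longrightarrow> ?R" using revealed_observe[OF r] by (metis option.inject option.distinct(1))
next
  assume ?R
  then obtain w' where w': "observe \<sigma> r w' = x"
    and eq: "\<And>j y. revealed j x = Some y \<Longrightarrow> reveal (w j) = y" by auto
  have eq: "reveal (w j) = reveal (w' j)" if "inspects \<sigma> r (fst \<circ> w') j" for j
    using eq[of j] revealed_observe[OF r, of j \<sigma> w'] w' that by simp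
  then have fit: "fst (w j) = fst (w' j)" "fst (w' j) \<Longrightarrow> snd (w j) = snd (w' j)"
    if "inspects \<sigma> r (fst \<circ> w') j" for j
    using that by (auto simp: reveal_def)
  have ins: "inspects \<sigma> r (fst \<circ> w) = inspects \<sigma> r (fst \<circ> w')"
    using fit by (intro inspects_cong) simp
  have "fst (observe \<sigma> r w) = fst (observe \<sigma> r w')"
    unfolding fst_observe ins using fit by auto
  moreover have "snd (observe \<sigma> r w) = snd (observe \<sigma> r w')"
  proof (cases "\<exists>j. inspects \<sigma> r (fst \<circ> w') j \<and> fst (w' j)")
    case True
    then obtain j where j: "inspects \<sigma> r (fst \<circ> w') j" "fst (w' j)" by auto
    then show ?thesis
      using snd_observe[OF r, of \<sigma> w' j] snd_observe[OF r, of \<sigma> w j] ins fit by simp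
  next
    case False
    then have "\<not> (\<exists>j. inspects \<sigma> r (fst \<circ> w) j \<and> fst (w j))" using ins fit by auto
    with False show ?thesis by (auto simp: observe_def Let_def)
  qed
  ultimately show ?L using w' by (metis prod.collapse)
qed

text \<open>Like histories, records list the latest observation first, so a later stage has the form
  \<open>K @ L\<close> with \<open>L\<close> the earlier one.\<close>

definition records :: "'b \<Rightarrow> 'b hist \<Rightarrow> (bool \<times> bool) list" where
  "records j h = List.map_filter (revealed j) h"

lemma records_simps [simp]:
  "records j [] = []"
  "records j (x # h) = (case revealed j x of None \<Rightarrow> records j h | Some y \<Rightarrow> y # records j h)"
  by (auto simp: records_def List.map_filter_simps split: option.split)

lemma records_reveal: "y \<in> set (records j h) \<Longrightarrow> reveal y = y"
  by (induction h) (auto split: option.splits simp: revealed_def reveal_def)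

section \<open>Likelihoods\<close>

definition fit_lik :: "(bool \<times> bool) list \<Rightarrow> real \<Rightarrow> real" where
  "fit_lik L p = (\<Prod>y\<leftarrow>L. pmf (bernoulli_pmf p) (fst y))"

definition qual_lik :: "(bool \<times> bool) list \<Rightarrow> real \<Rightarrow> real" where
  "qual_lik L p = (\<Prod>y\<leftarrow>L. if fst y then pmf (bernoulli_pmf p) (snd y) else 1)"

text \<open>The parameter of \<open>bernoulli_pmf\<close> is clamped to the unit interval, which
  gives continuity on the whole line and not only on [0,1].\<close>

lemma continuous_on_pmf_bernoulli: "continuous_on UNIV (\<lambda>p. pmf (bernoulli_pmf p) b)"
  unfolding bernoulli_pmf.rep_eq by (cases b) (auto intro!: continuous_intros simp: comp_def)

lemma continuous_on_fit_lik: "continuous_on UNIV (fit_lik L)"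
proof (induction L)
  case (Cons y L)
  then have "continuous_on UNIV (\<lambda>p. pmf (bernoulli_pmf p) (fst y) * fit_lik L p)"
    by (intro continuous_intros continuous_on_pmf_bernoulli)
  then show ?case by (simp add: fit_lik_def)
qed (simp add: fit_lik_def)

lemma continuous_on_qual_lik: "continuous_on UNIV (qual_lik L)"
proof (induction L)
  case (Cons y L)
  then have "continuous_on UNIV (\<lambda>p. pmf (bernoulli_pmf p) (snd y) * qual_lik L p)"
    by (intro continuous_intros continuous_on_pmf_bernoulli)
  with Cons show ?case by (cases "fst y") (simp_all add: qual_lik_def)
qed (simp add: qual_lik_def)

lemma measurable_fit_lik [measurable]: "fit_lik L \<in> borel_measurable borel"
  by (intro borel_measurable_continuous_onI continuous_on_fit_lik)

lemma measurable_qual_lik [measurable]: "qual_lik L \<in> borel_measurable borel"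
  by (intro borel_measurable_continuous_onI continuous_on_qual_lik)

lemma fit_lik_nonneg: "0 \<le> fit_lik L p"
  by (induction L) (auto simp: fit_lik_def)

lemma qual_lik_nonneg: "0 \<le> qual_lik L p"
  by (induction L) (auto simp: qual_lik_def)

text \<open>Every factor is a probability. Consequently a set that is null under a posterior remains
  null after more observations.\<close>

lemma fit_lik_append_le: "fit_lik (K @ L) p \<le> fit_lik L p"
proof (induction K)
  case (Cons y K)
  have "fit_lik ((y # K) @ L) p \<le> fit_lik (K @ L) p"
    using fit_lik_nonneg[of "K @ L" p]
    by (auto simp: fit_lik_def pmf_le_1 intro: mult_left_le_one_le)
  with Cons show ?case by (rule order_trans[rotated])
qed simp

lemma qual_lik_append_le: "qual_lik (K @ L) p \<le> qual_lik L p"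
proof (induction K)
  case (Cons y K)
  have "qual_lik ((y # K) @ L) p \<le> qual_lik (K @ L) p"
    using qual_lik_nonneg[of "K @ L" p]
    by (auto simp: qual_lik_def pmf_le_1 intro: mult_left_le_one_le)
  with Cons show ?case by (rule order_trans[rotated])
qed simp

lemma fit_lik_le_1: "fit_lik L p \<le> 1"
  using fit_lik_append_le[of L "[]" p] by (simp add: fit_lik_def)

lemma qual_lik_le_1: "qual_lik L p \<le> 1"
  using qual_lik_append_le[of L "[]" p] by (simp add: qual_lik_def)

text \<open>Without a fit, \<open>reveal\<close> merges both qualities, so the preimage contains
  both and the quality contributes the factor 1.\<close>

lemma emeasure_reveal:
  assumes "reveal y = y"
  shows "emeasure (measure_pmf (pair_pmf p q)) {w. reveal w = y} =
    ennreal (pmf p (fst y)) * ennreal (if fst y then pmf q (snd y) else 1)"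
proof (cases "fst y")
  case True
  then have "{w. reveal w = y} = {y}" by (cases y) (auto simp: reveal_def)
  moreover have "pmf (pair_pmf p q) y = pmf p (fst y) * pmf q (snd y)"
    by (cases y) (simp add: pmf_pair)
  ultimately show ?thesis using True
    by (simp add: emeasure_pmf_single ennreal_mult'')
next
  case False
  with assms have y: "y = (False, False)" by (cases y) (auto simp: reveal_def)
  then have "{w. reveal w = y} = {False} \<times> UNIV" by (auto simp: reveal_def)
  then show ?thesis
    by (simp add: y measure_pmf.emeasure_eq_measure measure_pmf_prob_product measure_pmf_single)
qed

section \<open>Probability of the record of a single round\<close>

definition agrees :: "'b obs \<Rightarrow> ('b \<Rightarrow> bool \<times> bool) \<Rightarrow> bool" where
  "agrees x w \<longleftrightarrow> (\<forall>j y. revealed j x = Some y \<longrightarrow> reveal (w j) = y)"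

text \<open>Quantifying the outcome away leaves a set of values, so that a round event becomes the
  rectangle of \<open>values_for M h x\<close> and the outcomes that agree with
  \<open>x\<close>.\<close>

definition values_for :: "('b::finite) market \<Rightarrow> 'b hist \<Rightarrow> 'b obs \<Rightarrow> real set" where
  "values_for M h x = {v. \<exists>w. round_obs M h (posterior M h) (v, w) = x}"

lemma valid_market_tie_rank:
  assumes "valid_market M"
  shows "inj (tie_rank M h v)" "(\<lambda>v. tie_rank M h v j) \<in> borel \<rightarrow>\<^sub>M count_space UNIV"
  using assms by (auto simp: valid_market_def)

lemma round_obs_eq_iff:
  assumes "valid_market M"
  shows "round_obs M h (posterior M h) s = x \<longleftrightarrow> fst s \<in> values_for M h x \<and> agrees x (snd s)"
  unfolding round_obs_def values_for_def agrees_def mem_Collect_eq fst_conv snd_conv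
  by (rule observe_eq_iff[OF valid_market_tie_rank(1)[OF assms]])

lemma measurable_inspects:
  fixes M :: "('b::finite) market"
  assumes "valid_market M"
  shows "Measurable.pred borel (\<lambda>v. inspects (index M B v) (tie_rank M h v) F j)"
proof -
  note [measurable] = valid_market_tie_rank(2)[OF assms]
  have [measurable]: "(\<lambda>v. index M B v j) \<in> borel_measurable borel" for j
  proof -
    have "(\<lambda>v::real. v * a - b - c) \<in> borel_measurable borel" for a b c by measurable
    then show ?thesis unfolding index_def .
  qed
  have [measurable]: "Measurable.pred borel (\<lambda>v. 0 < index M B v k)"
    "Measurable.pred borel (\<lambda>v. index M B v j < index M B v k)"
    "Measurable.pred borel (\<lambda>v. index M B v k = index M B v j)" for k
    by measurable
  have "Measurable.pred borel (\<lambda>v. tie_rank M h v k < tie_rank M h v j)" for k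
  proof -
    have "(\<lambda>v. (tie_rank M h v k, tie_rank M h v j)) \<in> borel \<rightarrow>\<^sub>M count_space UNIV \<Otimes>\<^sub>M count_space UNIV"
      by measurable
    then have "(\<lambda>v. (tie_rank M h v k, tie_rank M h v j)) \<in> borel \<rightarrow>\<^sub>M count_space UNIV"
      by (simp add: pair_measure_countable)
    from measurable_compose[OF this measurable_count_space, of "\<lambda>x. fst x < snd x"] show ?thesis by simp
  qed
  note [measurable] = this
  show ?thesis unfolding inspects_def precedes_def
    by (intro pred_intros_logic pred_intros_countable) measurable
qed

lemma measurable_values_for:
  assumes M: "valid_market M"
  shows "values_for M h x \<in> sets borel"
proof -
  let ?B = "posterior M h"
  have *: "{v. round_obs M h ?B (v, w) = x} \<in> sets borel" for w
  proof -
    define F where "F = fst \<circ> w"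
    define g where "g v = (\<lambda>j. inspects (index M ?B v) (tie_rank M h v) F j)" for v
    \<comment> \<open>For fixed outcomes the value acts only through the set of inspected
      businesses; \<open>G\<close> collects the finitely many such sets that lead to
      \<open>x\<close>.\<close>
    define G where "G = {I. ((\<lambda>j. if I j then Some (F j) else None,
        if \<exists>j. I j \<and> F j then (let j = (THE j. I j \<and> F j) in Some (j, snd (w j))) else None) = x)}"
    have "{v. round_obs M h ?B (v, w) = x} = g -` G"
      by (auto simp: round_obs_def observe_def G_def g_def F_def Let_def)
    also have "\<dots> = (\<Union>I\<in>G. {v. \<forall>j. g v j = I j})"
      unfolding fun_eq_iff[symmetric] by auto
    also have "\<dots> \<in> sets borel"
    proof (intro sets.finite_UN)
      have [measurable]: "Measurable.pred borel (\<lambda>v. g v j)" for j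
        unfolding g_def by (rule measurable_inspects[OF M])
      show "{v. \<forall>j. g v j = I j} \<in> sets borel" for I by measurable
    qed simp
    finally show ?thesis .
  qed
  have "values_for M h x = (\<Union>w. {v. round_obs M h ?B (v, w) = x})"
    by (auto simp: values_for_def)
  then show ?thesis using * by (auto intro!: sets.finite_UN)
qed

lemma emeasure_agrees:
  fixes x :: "('b::finite) obs"
  shows "emeasure (measure_pmf (Pi_pmf UNIV d p)) {w. agrees x w} =
    (\<Prod>j\<in>UNIV. case revealed j x of None \<Rightarrow> 1
       | Some y \<Rightarrow> emeasure (measure_pmf (p j)) {w. reveal w = y})"
proof -
  let ?B = "\<lambda>j. {y. \<forall>z. revealed j x = Some z \<longrightarrow> reveal y = z}"
  have "{w. agrees x w} = Pi UNIV ?B" by (auto simp: agrees_def)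
  then have "emeasure (measure_pmf (Pi_pmf UNIV d p)) {w. agrees x w} =
      (\<Prod>j\<in>UNIV. emeasure (measure_pmf (p j)) (?B j))"
    by (simp add: measure_pmf.emeasure_eq_measure measure_Pi_pmf_Pi prod_ennreal)
  also have "\<dots> = (\<Prod>j\<in>UNIV. case revealed j x of None \<Rightarrow> 1
       | Some y \<Rightarrow> emeasure (measure_pmf (p j)) {w. reveal w = y})"
    by (intro prod.cong refl) (auto split: option.split)
  finally show ?thesis .
qed

lemma valid_market_val_dist:
  assumes "valid_market M"
  shows "prob_space (val_dist M)" "sets (val_dist M) = sets borel" "space (val_dist M) = UNIV"
proof -
  have "real_distribution (val_dist M)"
    using assms by (simp add: valid_market_def value_distribution_def)
  then interpret real_distribution "val_dist M" .
  show "prob_space (val_dist M)" "sets (val_dist M) = sets borel" "space (val_dist M) = UNIV"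
    by (simp_all add: prob_space_axioms)
qed

lemma round_event:
  assumes M: "valid_market M"
  shows "{s \<in> space (shock_dist M \<theta>). round_obs M h (posterior M h) s = x} =
    values_for M h x \<times> {w. agrees x w}"
  using valid_market_val_dist[OF M]
  by (auto simp: round_obs_eq_iff[OF M] shock_dist_def space_pair_measure)

lemma emeasure_round_event:
  assumes M: "valid_market M"
  shows "emeasure (shock_dist M \<theta>) {s \<in> space (shock_dist M \<theta>). round_obs M h (posterior M h) s = x} =
    emeasure (val_dist M) (values_for M h x) *
    (\<Prod>j\<in>UNIV. case revealed j x of None \<Rightarrow> 1 | Some y \<Rightarrow>
       ennreal (pmf (bernoulli_pmf (fst \<theta> j)) (fst y)) *
       ennreal (if fst y then pmf (bernoulli_pmf (snd \<theta> j)) (snd y) else 1))"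
proof -
  have "emeasure (shock_dist M \<theta>) {s \<in> space (shock_dist M \<theta>). round_obs M h (posterior M h) s = x} =
     emeasure (val_dist M) (values_for M h x) *
     emeasure (measure_pmf (Pi_pmf UNIV (False, False)
       (\<lambda>j. pair_pmf (bernoulli_pmf (fst \<theta> j)) (bernoulli_pmf (snd \<theta> j))))) {w. agrees x w}"
    unfolding round_event[OF M] unfolding shock_dist_def
    using measurable_values_for[OF M] valid_market_val_dist[OF M]
    by (intro measure_pmf.emeasure_pair_measure_Times) auto
  also have "\<dots> = emeasure (val_dist M) (values_for M h x) *
    (\<Prod>j\<in>UNIV. case revealed j x of None \<Rightarrow> 1 | Some y \<Rightarrow>
       ennreal (pmf (bernoulli_pmf (fst \<theta> j)) (fst y)) *
       ennreal (if fst y then pmf (bernoulli_pmf (snd \<theta> j)) (snd y) else 1))"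
    unfolding emeasure_agrees
    by (intro arg_cong2[where f="(*)"] refl prod.cong option.case_cong emeasure_reveal)
       (auto simp: revealed_def reveal_def)
  finally show ?thesis .
qed

primrec value_lik :: "('b::finite) market \<Rightarrow> 'b hist \<Rightarrow> ennreal" where
  "value_lik M [] = 1"
| "value_lik M (x # h) = value_lik M h * emeasure (val_dist M) (values_for M h x)"

text \<open>
  Only the consumers' values enter the order of inspection, so that the likelihood factorises
  over the individual parameters.
\<close>

lemma lik_factorises:
  assumes M: "valid_market M"
  shows "lik M h \<theta> = value_lik M h * ((\<Prod>j\<in>UNIV. ennreal (fit_lik (records j h) (fst \<theta> j))) *
    (\<Prod>j\<in>UNIV. ennreal (qual_lik (records j h) (snd \<theta> j))))"
proof (induction h)
  case (Cons x h)
  have "lik M (x # h) \<theta> = value_lik M h * emeasure (val_dist M) (values_for M h x) *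
    (\<Prod>j\<in>UNIV. ennreal (fit_lik (records j h) (fst \<theta> j)) * ennreal (qual_lik (records j h) (snd \<theta> j)) *
      (case revealed j x of None \<Rightarrow> 1 | Some y \<Rightarrow>
       ennreal (pmf (bernoulli_pmf (fst \<theta> j)) (fst y)) *
       ennreal (if fst y then pmf (bernoulli_pmf (snd \<theta> j)) (snd y) else 1)))"
    unfolding lik.simps posterior_def[symmetric] emeasure_round_event[OF M] Cons.IH
    by (simp add: prod.distrib mult_ac)
  also have "(\<Prod>j\<in>UNIV. ennreal (fit_lik (records j h) (fst \<theta> j)) * ennreal (qual_lik (records j h) (snd \<theta> j)) *
      (case revealed j x of None \<Rightarrow> 1 | Some y \<Rightarrow>
       ennreal (pmf (bernoulli_pmf (fst \<theta> j)) (fst y)) *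
       ennreal (if fst y then pmf (bernoulli_pmf (snd \<theta> j)) (snd y) else 1))) =
    (\<Prod>j\<in>UNIV. ennreal (fit_lik (records j (x # h)) (fst \<theta> j)) * ennreal (qual_lik (records j (x # h)) (snd \<theta> j)))"
    by (intro prod.cong refl)
       (auto split: option.split simp: fit_lik_def qual_lik_def ennreal_mult'' ennreal_mult' mult_ac)
  finally show ?case by (simp add: prod.distrib mult_ac)
qed (simp add: fit_lik_def qual_lik_def)

section \<open>Posteriors\<close>

text \<open>The one-dimensional counterpart of \<open>bayes\<close>: the prior \<open>\<mu>\<close>
  of one parameter reweighted by its likelihood \<open>g\<close> and normalised.\<close>

definition tilted :: "real measure \<Rightarrow> (real \<Rightarrow> real) \<Rightarrow> real measure" where
  "tilted \<mu> g = density \<mu> (\<lambda>x. ennreal (g x) / (\<integral>\<^sup>+ y. ennreal (g y) \<partial>\<mu>))"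

lemma emeasure_tilted:
  assumes "sets \<mu> = sets borel" and g: "g \<in> borel_measurable borel" and S: "S \<in> sets borel"
  shows "emeasure (tilted \<mu> g) S =
    (\<integral>\<^sup>+x. ennreal (g x) * indicator S x \<partial>\<mu>) / (\<integral>\<^sup>+x. ennreal (g x) \<partial>\<mu>)"
proof -
  have [measurable]: "g \<in> borel_measurable \<mu>" "S \<in> sets \<mu>"
    using assms by (simp_all add: measurable_cong_sets[OF assms(1) refl])
  have "emeasure (tilted \<mu> g) S =
      (\<integral>\<^sup>+x. ennreal (g x) * indicator S x / (\<integral>\<^sup>+x. ennreal (g x) \<partial>\<mu>) \<partial>\<mu>)"
    unfolding tilted_def
    by (subst emeasure_density) (auto intro!: nn_integral_cong simp: divide_ennreal_def mult_ac)
  then show ?thesis by (simp add: nn_integral_divide)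
qed

lemma valid_market_priors:
  assumes "valid_market M"
  shows "prob_space (prior_fit M j)" "sets (prior_fit M j) = sets borel" "space (prior_fit M j) = UNIV"
    "prob_space (prior_qual M j)" "sets (prior_qual M j) = sets borel" "space (prior_qual M j) = UNIV"
proof -
  have "real_distribution (prior_fit M j)" "real_distribution (prior_qual M j)"
    using assms by (auto simp: valid_market_def)
  then interpret f: real_distribution "prior_fit M j" + q: real_distribution "prior_qual M j" .
  show "prob_space (prior_fit M j)" "sets (prior_fit M j) = sets borel" "space (prior_fit M j) = UNIV"
    "prob_space (prior_qual M j)" "sets (prior_qual M j) = sets borel" "space (prior_qual M j) = UNIV"
    by (simp_all add: f.prob_space_axioms q.prob_space_axioms)
qed

lemma measurable_prior_iff:
  assumes M: "valid_market M"
  shows "borel_measurable (prior M) = borel_measurable ((\<Pi>\<^sub>M j\<in>UNIV. borel) \<Otimes>\<^sub>M (\<Pi>\<^sub>M j\<in>UNIV. borel))"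
  unfolding prior_def
  by (intro measurable_cong_sets sets_pair_measure_cong sets_PiM_cong refl) (simp_all add: valid_market_priors[OF M])

lemma nn_integral_prior:
  fixes M :: "('b::finite) market"
  assumes M: "valid_market M"
    and [measurable]: "\<And>j. f j \<in> borel_measurable borel" "\<And>j. g j \<in> borel_measurable borel"
  shows "(\<integral>\<^sup>+\<theta>. (\<Prod>j\<in>UNIV. f j (fst \<theta> j)) * (\<Prod>j\<in>UNIV. g j (snd \<theta> j)) \<partial>prior M) =
    (\<Prod>j\<in>UNIV. \<integral>\<^sup>+x. f j x \<partial>prior_fit M j) * (\<Prod>j\<in>UNIV. \<integral>\<^sup>+x. g j x \<partial>prior_qual M j)"
proof -
  note P = valid_market_priors[OF M]
  interpret f: product_prob_space "prior_fit M" UNIV by (rule product_prob_spaceI) (rule P)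
  interpret q: product_prob_space "prior_qual M" UNIV by (rule product_prob_spaceI) (rule P)
  have [measurable]: "\<And>j. f j \<in> borel_measurable (prior_fit M j)" "\<And>j. g j \<in> borel_measurable (prior_qual M j)"
    using assms(2,3) by (simp_all add: measurable_cong_sets[OF P(2) refl] measurable_cong_sets[OF P(5) refl])
  let ?F = "PiM UNIV (prior_fit M)" and ?Q = "PiM UNIV (prior_qual M)"
  have "(\<integral>\<^sup>+\<theta>. (\<Prod>j\<in>UNIV. f j (fst \<theta> j)) * (\<Prod>j\<in>UNIV. g j (snd \<theta> j)) \<partial>prior M) =
     (\<integral>\<^sup>+a. \<integral>\<^sup>+b. (\<Prod>j\<in>UNIV. f j (a j)) * (\<Prod>j\<in>UNIV. g j (b j)) \<partial>?Q \<partial>?F)"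
    unfolding prior_def by (subst q.nn_integral_fst[symmetric]) (simp_all, measurable)
  also have "\<dots> = (\<integral>\<^sup>+a. (\<Prod>j\<in>UNIV. f j (a j)) \<partial>?F) * (\<integral>\<^sup>+b. (\<Prod>j\<in>UNIV. g j (b j)) \<partial>?Q)"
    by (simp add: nn_integral_cmult nn_integral_multc)
  also have "(\<integral>\<^sup>+a. (\<Prod>j\<in>UNIV. f j (a j)) \<partial>?F) = (\<Prod>j\<in>UNIV. \<integral>\<^sup>+x. f j x \<partial>prior_fit M j)"
    by (rule f.product_nn_integral_prod) simp_all
  also have "(\<integral>\<^sup>+b. (\<Prod>j\<in>UNIV. g j (b j)) \<partial>?Q) = (\<Prod>j\<in>UNIV. \<integral>\<^sup>+x. g j x \<partial>prior_qual M j)"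
    by (rule q.product_nn_integral_prod) simp_all
  finally show ?thesis .
qed

text \<open>By continuity \<open>f\<close> is positive on an open set around \<open>a\<close>, and
  such a set has positive mass. Through this fact the assumption that the true parameters lie in the
  support of the prior makes the normalisers of Bayes' rule positive.\<close>

lemma nn_integral_pos_of_msupport:
  assumes "sets \<mu> = sets borel" "a \<in> msupport \<mu>" "continuous_on UNIV f" "0 < f a"
  shows "0 < (\<integral>\<^sup>+x. ennreal (f x) \<partial>\<mu>)"
proof -
  have "open {x. 0 < f x}" using assms(3) by (intro open_Collect_less continuous_intros)
  then have "0 < emeasure \<mu> {x. 0 < f x}" using assms(2,4) by (auto simp: msupport_def)
  moreover have f: "f \<in> borel_measurable \<mu>"
    unfolding measurable_cong_sets[OF assms(1) refl] by (rule borel_measurable_continuous_onI[OF assms(3)])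
  moreover have "{x. 0 < f x} = {x\<in>space \<mu>. ennreal (f x) \<noteq> 0}"
    using sets_eq_imp_space_eq[OF assms(1)] by (auto simp: ennreal_eq_0_iff)
  ultimately have "(\<integral>\<^sup>+x. ennreal (f x) \<partial>\<mu>) \<noteq> 0"
    by (subst nn_integral_0_iff) simp_all
  then show ?thesis by (simp add: zero_less_iff_neq_zero)
qed

lemma nn_integral_fit_lik_le_1: "prob_space \<mu> \<Longrightarrow> (\<integral>\<^sup>+x. ennreal (fit_lik L x) \<partial>\<mu>) \<le> 1"
  using nn_integral_mono[of \<mu> "\<lambda>x. ennreal (fit_lik L x)" "\<lambda>_. 1"]
  by (simp add: fit_lik_le_1 prob_space.emeasure_space_1)

lemma nn_integral_qual_lik_le_1: "prob_space \<mu> \<Longrightarrow> (\<integral>\<^sup>+x. ennreal (qual_lik L x) \<partial>\<mu>) \<le> 1"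
  using nn_integral_mono[of \<mu> "\<lambda>x. ennreal (qual_lik L x)" "\<lambda>_. 1"]
  by (simp add: qual_lik_le_1 prob_space.emeasure_space_1)

lemma value_lik_le_1: "valid_market M \<Longrightarrow> value_lik M h \<le> 1"
proof (induction h)
  case (Cons x h)
  interpret prob_space "val_dist M" by (rule valid_market_val_dist[OF Cons.prems])
  show ?case using mult_mono[OF Cons.IH[OF Cons.prems] emeasure_le_1] by simp
qed simp

lemma lik_pos_D:
  assumes M: "valid_market M" and pos: "lik M h (true_param M) \<noteq> 0"
  shows "value_lik M h \<noteq> 0" "0 < (\<integral>\<^sup>+x. ennreal (fit_lik (records j h) x) \<partial>prior_fit M j)"
    "0 < (\<integral>\<^sup>+x. ennreal (qual_lik (records j h) x) \<partial>prior_qual M j)"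
proof -
  note P = valid_market_priors[OF M]
  show "value_lik M h \<noteq> 0" using pos unfolding lik_factorises[OF M] by auto
  have "0 < fit_lik (records j h) (fit_prob M j)" "0 < qual_lik (records j h) (quality M j)"
    using pos unfolding lik_factorises[OF M] by (auto simp: true_param_def ennreal_eq_0_iff not_le)
  then show "0 < (\<integral>\<^sup>+x. ennreal (fit_lik (records j h) x) \<partial>prior_fit M j)"
    "0 < (\<integral>\<^sup>+x. ennreal (qual_lik (records j h) x) \<partial>prior_qual M j)"
    using M by (auto intro!: nn_integral_pos_of_msupport continuous_on_fit_lik continuous_on_qual_lik P
      simp: valid_market_def)
qed

lemma index_posterior:
  assumes M: "valid_market M"
  shows "index M (posterior M h) v j =
    v * (\<integral>x. x \<partial>post_qual M h j) - price M j - search_cost M / (\<integral>x. x \<partial>post_fit M h j)"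
proof -
  have [measurable]: "(\<lambda>\<theta>. fst \<theta> j) \<in> borel_measurable (prior M)"
    "(\<lambda>\<theta>. snd \<theta> j) \<in> borel_measurable (prior M)"
    unfolding measurable_prior_iff[OF M] by measurable
  have "(\<lambda>\<theta>. fst \<theta> j) \<in> borel_measurable (posterior M h)"
    "(\<lambda>\<theta>. snd \<theta> j) \<in> borel_measurable (posterior M h)"
    unfolding posterior_def bayes_def by simp_all
  then show ?thesis
    unfolding index_def post_fit_def post_qual_def by (simp add: integral_distr)
qed

text \<open>The cancellation behind the posterior marginals: \<open>c\<close> is the likelihood of
  the values, \<open>a\<close> the normaliser of the parameter in question, \<open>p\<close> and
  \<open>q\<close> those of all others. Cancelling in \<open>ennreal\<close> requires each of them
  to be neither 0 nor infinite.\<close>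

lemma ennreal_normalise:
  fixes a c i p q :: ennreal
  assumes "a \<noteq> 0" "c \<noteq> 0" "p \<noteq> 0" "q \<noteq> 0" "a < top" "c < top" "p < top" "q < top"
  shows "c / (c * (a * p * q)) * (i * p * q) = i / a"
proof -
  have "c / (c * (a * p * q)) * (i * p * q) = ((c * p * q) * i) / ((c * p * q) * a)"
    by (simp add: ennreal_times_divide divide_ennreal_def mult_ac)
  also have "\<dots> = i / a"
  proof -
    define K where "K = c * p * q"
    have K: "K \<noteq> 0" "K < top" using assms by (auto simp: K_def ennreal_mult_less_top)
    have "K * i / (K * a) = K * inverse K * (i * inverse a)"
      using K assms by (simp add: divide_ennreal_def ennreal_inverse_mult mult_ac)
    then show ?thesis unfolding K_def[symmetric]
      using ennreal_divide_self[OF K] by (simp add: divide_ennreal_def)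
  qed
  finally show ?thesis .
qed

text \<open>Likelihood and prior both factorise, hence so does the normaliser; the factors of all
  other parameters and of the values cancel. The search cost thus affects the posterior of
  \<open>j\<close> only through the record of \<open>j\<close>.\<close>

lemma posterior_marginals:
  fixes M :: "('b::finite) market"
  assumes M: "valid_market M" and pos: "lik M h (true_param M) \<noteq> 0"
  shows "post_fit M h j = tilted (prior_fit M j) (fit_lik (records j h))"
    and "post_qual M h j = tilted (prior_qual M j) (qual_lik (records j h))"
proof -
  note P = valid_market_priors[OF M]
  define C where "C = value_lik M h"
  define a where "a k x = ennreal (fit_lik (records k h) x)" for k x
  define b where "b k x = ennreal (qual_lik (records k h) x)" for k x
  define A where "A k = (\<integral>\<^sup>+x. a k x \<partial>prior_fit M k)" for k
  define B where "B k = (\<integral>\<^sup>+x. b k x \<partial>prior_qual M k)" for k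
  have [measurable]: "a k \<in> borel_measurable borel" "b k \<in> borel_measurable borel" for k
    unfolding a_def b_def by measurable
  have A: "A k \<noteq> 0" "A k < top" for k
    using lik_pos_D(2,3)[OF M pos, of k] nn_integral_fit_lik_le_1[OF P(1)[of k], of "records k h"]
    by (auto simp: A_def a_def intro: order.strict_trans1)
  have B: "B k \<noteq> 0" "B k < top" for k
    using lik_pos_D(2,3)[OF M pos, of k] nn_integral_qual_lik_le_1[OF P(4)[of k], of "records k h"]
    by (auto simp: B_def b_def intro: order.strict_trans1)
  have C: "C \<noteq> 0" "C < top"
    using lik_pos_D(1)[OF M pos] value_lik_le_1[OF M, of h] by (auto simp: C_def intro: order.strict_trans1)
  have prods: "(\<Prod>k\<in>S. A k) \<noteq> 0" "(\<Prod>k\<in>S. A k) < top" "(\<Prod>k\<in>S. B k) \<noteq> 0" "(\<Prod>k\<in>S. B k) < top" for S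
    using A B by (auto simp: less_top[symmetric] ennreal_prod_eq_top prod_zero_iff)
  have L: "lik M h \<theta> = C * ((\<Prod>k\<in>UNIV. a k (fst \<theta> k)) * (\<Prod>k\<in>UNIV. b k (snd \<theta> k)))" for \<theta>
    unfolding lik_factorises[OF M] C_def a_def b_def ..
  have mf: "(\<lambda>\<theta>. fst \<theta> k) \<in> borel_measurable (prior M)" for k
    unfolding measurable_prior_iff[OF M] by measurable
  have mq: "(\<lambda>\<theta>. snd \<theta> k) \<in> borel_measurable (prior M)" for k
    unfolding measurable_prior_iff[OF M] by measurable
  note [measurable] = mf mq
  have [measurable]: "lik M h \<in> borel_measurable (prior M)"
    unfolding L[abs_def] by measurable
  define Z where "Z = (\<integral>\<^sup>+\<theta>. lik M h \<theta> \<partial>prior M)"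
  have Z: "Z = C * ((\<Prod>k\<in>UNIV. A k) * (\<Prod>k\<in>UNIV. B k))"
    unfolding Z_def L A_def B_def by (subst nn_integral_cmult) (simp_all add: nn_integral_prior[OF M])
  have post: "posterior M h = density (prior M) (\<lambda>\<theta>. lik M h \<theta> / Z)"
    unfolding posterior_def bayes_def Z_def ..
  show "post_fit M h j = tilted (prior_fit M j) (fit_lik (records j h))"
  proof (rule measure_eqI)
    fix S assume "S \<in> sets (post_fit M h j)"
    then have S[measurable]: "S \<in> sets borel" by (simp add: post_fit_def)
    \<comment> \<open>Moving the indicator of \<open>S\<close> into factor \<open>j\<close> keeps
      the integrand a product, so that \<open>nn_integral_prior\<close> applies to the numerator as
      well.\<close>
    define a' where "a' k x = (if k = j then a k x * indicator S x else a k x)" for k x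
    have [measurable]: "a' k \<in> borel_measurable borel" for k
      unfolding a'_def by measurable
    define I where "I = (\<integral>\<^sup>+x. a j x * indicator S x \<partial>prior_fit M j)"
    have a': "(\<Prod>k\<in>UNIV. a' k (x k)) = (\<Prod>k\<in>UNIV. a k (x k)) * indicator S (x j)" for x
      by (simp add: a'_def prod.remove[of UNIV j] mult_ac)
    have I: "(\<Prod>k\<in>UNIV. \<integral>\<^sup>+x. a' k x \<partial>prior_fit M k) = I * (\<Prod>k\<in>UNIV - {j}. A k)"
      by (simp add: a'_def prod.remove[of UNIV j] I_def A_def)
    have "emeasure (post_fit M h j) S = (\<integral>\<^sup>+\<theta>. lik M h \<theta> / Z * indicator S (fst \<theta> j) \<partial>prior M)"
      unfolding post_fit_def
      by (subst emeasure_distr) (auto simp: post emeasure_density indicator_def intro!: nn_integral_cong)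
    also have "\<dots> = (\<integral>\<^sup>+\<theta>. C / Z * ((\<Prod>k\<in>UNIV. a' k (fst \<theta> k)) * (\<Prod>k\<in>UNIV. b k (snd \<theta> k))) \<partial>prior M)"
      unfolding L a' by (simp add: divide_ennreal_def mult_ac)
    also have "\<dots> = C / Z * (I * (\<Prod>k\<in>UNIV - {j}. A k) * (\<Prod>k\<in>UNIV. B k))"
      by (subst nn_integral_cmult) (simp_all add: nn_integral_prior[OF M] I B_def)
    also have "\<dots> = I / A j"
      unfolding Z prod.remove[of UNIV j A, simplified] using A B C prods
      by (intro ennreal_normalise) auto
    also have "\<dots> = emeasure (tilted (prior_fit M j) (fit_lik (records j h))) S"
      unfolding I_def A_def a_def
      by (rule emeasure_tilted[symmetric]) (simp_all add: P)
    finally show "emeasure (post_fit M h j) S = \<dots>" .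
  qed (simp add: post_fit_def tilted_def P)
  show "post_qual M h j = tilted (prior_qual M j) (qual_lik (records j h))"
  proof (rule measure_eqI)
    fix S assume "S \<in> sets (post_qual M h j)"
    then have S[measurable]: "S \<in> sets borel" by (simp add: post_qual_def)
    define b' where "b' k x = (if k = j then b k x * indicator S x else b k x)" for k x
    have [measurable]: "b' k \<in> borel_measurable borel" for k
      unfolding b'_def by measurable
    define I where "I = (\<integral>\<^sup>+x. b j x * indicator S x \<partial>prior_qual M j)"
    have b': "(\<Prod>k\<in>UNIV. b' k (x k)) = (\<Prod>k\<in>UNIV. b k (x k)) * indicator S (x j)" for x
      by (simp add: b'_def prod.remove[of UNIV j] mult_ac)
    have I: "(\<Prod>k\<in>UNIV. \<integral>\<^sup>+x. b' k x \<partial>prior_qual M k) = I * (\<Prod>k\<in>UNIV - {j}. B k)"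
      by (simp add: b'_def prod.remove[of UNIV j] I_def B_def)
    have "emeasure (post_qual M h j) S = (\<integral>\<^sup>+\<theta>. lik M h \<theta> / Z * indicator S (snd \<theta> j) \<partial>prior M)"
      unfolding post_qual_def
      by (subst emeasure_distr) (auto simp: post emeasure_density indicator_def intro!: nn_integral_cong)
    also have "\<dots> = (\<integral>\<^sup>+\<theta>. C / Z * ((\<Prod>k\<in>UNIV. a k (fst \<theta> k)) * (\<Prod>k\<in>UNIV. b' k (snd \<theta> k))) \<partial>prior M)"
      unfolding L b' by (simp add: divide_ennreal_def mult_ac)
    also have "\<dots> = C / Z * ((\<Prod>k\<in>UNIV. A k) * (I * (\<Prod>k\<in>UNIV - {j}. B k)))"
      by (subst nn_integral_cmult) (simp_all add: nn_integral_prior[OF M] I A_def)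
    also have "\<dots> = C / (C * (B j * (\<Prod>k\<in>UNIV - {j}. B k) * (\<Prod>k\<in>UNIV. A k))) *
        (I * (\<Prod>k\<in>UNIV - {j}. B k) * (\<Prod>k\<in>UNIV. A k))"
      unfolding Z prod.remove[of UNIV j B, simplified] by (simp add: mult_ac)
    also have "\<dots> = I / B j"
      using A B C prods by (intro ennreal_normalise) auto
    also have "\<dots> = emeasure (tilted (prior_qual M j) (qual_lik (records j h))) S"
      unfolding I_def B_def b_def
      by (rule emeasure_tilted[symmetric]) (simp_all add: P)
    finally show "emeasure (post_qual M h j) S = \<dots>" .
  qed (simp add: post_qual_def tilted_def P)
qed

section \<open>The law of the history\<close>

lemma past_simps [simp]: "past X 0 = []" "past X (Suc n) = X n # past X n"
  by (simp_all add: past_def)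

lemma length_past [simp]: "length (past X n) = n"
  by (simp add: past_def)

lemma past_nth: "i < n \<Longrightarrow> rev (past X n) ! i = X i"
  by (simp add: past_def)

lemma measurable_past [measurable]:
  "(\<lambda>X. past X n) \<in> (\<Pi>\<^sub>M n\<in>UNIV. count_space (UNIV :: ('b::finite) obs set)) \<rightarrow>\<^sub>M count_space UNIV"
proof (induction n)
  case (Suc n)
  have "(\<lambda>X. (X n, past X n)) \<in> (\<Pi>\<^sub>M n\<in>UNIV. count_space (UNIV :: 'b obs set)) \<rightarrow>\<^sub>M
      count_space UNIV \<Otimes>\<^sub>M count_space UNIV"
    using Suc by measurable
  then have "(\<lambda>X. (X n, past X n)) \<in> (\<Pi>\<^sub>M n\<in>UNIV. count_space (UNIV :: 'b obs set)) \<rightarrow>\<^sub>M count_space UNIV"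
    by (simp add: pair_measure_countable)
  from measurable_compose[OF this measurable_count_space, of "\<lambda>(x, h). x # h"]
  show ?case by simp
qed simp

lemma sets_past_event:
  "{X. past X n = h} \<in> sets (\<Pi>\<^sub>M n\<in>UNIV. count_space (UNIV :: ('b::finite) obs set))"
  using measurable_sets[OF measurable_past[of n], of "{h}"] by (simp add: vimage_def space_PiM)

text \<open>Any finite set of coordinates lies within the first \<open>n\<close> rounds, and finite
  histories form a countable type, so the probabilities of single pasts determine those of all
  cylinders.\<close>

lemma measure_eqI_past:
  fixes P Q :: "(nat \<Rightarrow> ('b::finite) obs) measure"
  assumes P: "prob_space P" "sets P = sets (\<Pi>\<^sub>M n\<in>UNIV. count_space UNIV)"
    and Q: "prob_space Q" "sets Q = sets (\<Pi>\<^sub>M n\<in>UNIV. count_space UNIV)"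
    and eq: "\<And>h. emeasure P {X. past X (length h) = h} = emeasure Q {X. past X (length h) = h}"
  shows "P = Q"
proof (rule measure_eqI_PiM_infinite[OF P(2) Q(2)])
  interpret P: prob_space P by fact
  show "finite_measure P" by (rule P.finite_measure_axioms)
  fix A :: "nat \<Rightarrow> 'b obs set" and J :: "nat set"
  assume "finite J"
  then obtain n where n: "J \<subseteq> {..<n}" by (auto dest: finite_nat_bounded)
  have m: "(\<lambda>X. past X k) \<in> P \<rightarrow>\<^sub>M count_space UNIV" "(\<lambda>X. past X k) \<in> Q \<rightarrow>\<^sub>M count_space UNIV" for k
    unfolding measurable_cong_sets[OF P(2) refl] measurable_cong_sets[OF Q(2) refl] by simp_all
  have sp: "space P = UNIV" "space Q = UNIV"
    using sets_eq_imp_space_eq[OF P(2)] sets_eq_imp_space_eq[OF Q(2)] by (simp_all add: space_PiM)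
  have law: "distr P (count_space UNIV) (\<lambda>X. past X n) = distr Q (count_space UNIV) (\<lambda>X. past X n)"
  proof (rule measure_eqI_countable[where A = UNIV])
    fix h :: "'b hist"
    show "emeasure (distr P (count_space UNIV) (\<lambda>X. past X n)) {h} =
        emeasure (distr Q (count_space UNIV) (\<lambda>X. past X n)) {h}"
    proof (cases "length h = n")
      case True
      then have "(\<lambda>X. past X n) -` {h} = {X. past X (length h) = h}" by auto
      then show ?thesis using eq[of h] by (simp add: emeasure_distr m sp)
    next
      case False
      then have "(\<lambda>X. past X n) -` {h} = {}" by auto
      then show ?thesis by (simp add: emeasure_distr m)
    qed
  qed simp_all
  \<comment> \<open>The reversal accounts for histories listing the latest round first:
    \<open>rev h ! i\<close> is round \<open>i\<close>.\<close>
  define H where "H = {h :: 'b hist. \<forall>i\<in>J. rev h ! i \<in> A i}"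
  have "prod_emb UNIV (\<lambda>n. count_space UNIV) J (Pi\<^sub>E J A) = {X. \<forall>i\<in>J. X i \<in> A i}"
    by (auto simp: prod_emb_def restrict_PiE_iff)
  also have "\<dots> = (\<lambda>X. past X n) -` H"
    using n by (auto simp: H_def past_nth subset_iff)
  finally have cyl: "prod_emb UNIV (\<lambda>n. count_space UNIV) J (Pi\<^sub>E J A) = (\<lambda>X. past X n) -` H" .
  have "emeasure P ((\<lambda>X. past X n) -` H) = emeasure (distr P (count_space UNIV) (\<lambda>X. past X n)) H"
    by (simp add: emeasure_distr m sp)
  also have "\<dots> = emeasure Q ((\<lambda>X. past X n) -` H)"
    unfolding law by (simp add: emeasure_distr m sp)
  finally show "emeasure P (prod_emb UNIV (\<lambda>n. count_space UNIV) J (Pi\<^sub>E J A)) =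
      emeasure Q (prod_emb UNIV (\<lambda>n. count_space UNIV) J (Pi\<^sub>E J A))"
    unfolding cyl .
qed

lemma measurable_history_process:
  fixes f :: "'w \<Rightarrow> nat \<Rightarrow> ('b::finite) obs"
  assumes "\<And>h. {\<omega> \<in> space N. past (f \<omega>) (length h) = h} \<in> sets N"
  shows "f \<in> N \<rightarrow>\<^sub>M (\<Pi>\<^sub>M n\<in>UNIV. count_space UNIV)"
proof (rule measurable_PiM_single')
  fix n
  have "(\<lambda>\<omega>. past (f \<omega>) (Suc n)) \<in> N \<rightarrow>\<^sub>M count_space UNIV"
  proof (subst measurable_count_space_eq2_countable, intro conjI ballI)
    fix h
    show "(\<lambda>\<omega>. past (f \<omega>) (Suc n)) -` {h} \<inter> space N \<in> sets N"
    proof (cases "length h = Suc n")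
      case True
      have "{\<omega> \<in> space N. past (f \<omega>) (Suc n) = h} \<in> sets N" using assms[of h] unfolding True .
      then show ?thesis by (simp add: vimage_def Int_def conj_commute del: past_simps)
    next
      case False
      then have "past (f \<omega>) (Suc n) \<noteq> h" for \<omega>
        using length_past[of "f \<omega>" "Suc n"] by metis
      then show ?thesis by (simp add: vimage_def del: past_simps)
    qed
  qed auto
  from measurable_compose[OF this measurable_count_space, of hd]
  show "(\<lambda>\<omega>. f \<omega> n) \<in> N \<rightarrow>\<^sub>M count_space UNIV" by simp
qed auto

section \<open>Probabilities of finite histories\<close>

lemma valid_market_shock_dist:
  assumes "valid_market M"
  shows "prob_space (shock_dist M \<theta>)" "space (shock_dist M \<theta>) = UNIV"
proof -
  interpret v: prob_space "val_dist M" by (rule valid_market_val_dist[OF assms])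
  show "prob_space (shock_dist M \<theta>)"
    unfolding shock_dist_def by (intro prob_space_pair v.prob_space_axioms measure_pmf.prob_space_axioms)
  show "space (shock_dist M \<theta>) = UNIV"
    using valid_market_val_dist[OF assms] by (simp add: shock_dist_def space_pair_measure)
qed

lemma sets_round_event:
  assumes M: "valid_market M"
  shows "{s. round_obs M h (posterior M h) s = x} \<in> sets (shock_dist M \<theta>)"
proof -
  have "values_for M h x \<times> {w. agrees x w} \<in> sets (shock_dist M \<theta>)"
    unfolding shock_dist_def
    using measurable_values_for[OF M] valid_market_val_dist[OF M] by (intro pair_measureI) auto
  then show ?thesis
    using round_event[OF M, of \<theta> h x] valid_market_shock_dist[OF M] by simp
qed

text \<open>The set in which the shock of round \<open>i\<close> must lie for \<open>h\<close> to
  result. Since rounds are numbered from 0, the head of \<open>x # h\<close> is round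
  \<open>length h\<close>. The sets depend on \<open>h\<close> alone, so the event that
  \<open>h\<close> occurs is a box in independent shocks.\<close>

primrec round_events :: "('b::finite) market \<Rightarrow> 'b hist \<Rightarrow> nat \<Rightarrow> 'b shock set" where
  "round_events M [] i = UNIV"
| "round_events M (x # h) i =
    (if i = length h then {s. round_obs M h (posterior M h) s = x} else round_events M h i)"

lemma run_eq_iff: "run M \<omega> (length h) = h \<longleftrightarrow> (\<forall>i<length h. \<omega> i \<in> round_events M h i)"
proof (induction h)
  case (Cons x h)
  show ?case using Cons by (auto simp: less_Suc_eq)
qed simp

lemma past_history: "past (history M \<omega>) n = run M \<omega> n"
  by (induction n) (simp_all add: history_def)

lemma
  assumes M: "valid_market M"
  shows sets_run_event: "{\<omega>. run M \<omega> (length h) = h} \<in> sets (\<Pi>\<^sub>M n\<in>UNIV. shock_dist M (true_param M))"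
    and emeasure_run_event: "emeasure (\<Pi>\<^sub>M n\<in>UNIV. shock_dist M (true_param M))
      {\<omega>. run M \<omega> (length h) = h} = lik M h (true_param M)"
proof -
  let ?S = "shock_dist M (true_param M)"
  interpret product_prob_space "\<lambda>_. ?S" "UNIV :: nat set"
    by (rule product_prob_spaceI) (rule valid_market_shock_dist[OF M])
  have ev: "round_events M h i \<in> sets ?S" for i
    using sets_round_event[OF M] sets.top[of ?S] valid_market_shock_dist[OF M] by (induction h) auto
  have run: "{\<omega>. run M \<omega> (length h) = h} =
      {\<omega> \<in> space (\<Pi>\<^sub>M n\<in>UNIV. ?S). \<forall>i\<in>{..<length h}. \<omega> i \<in> round_events M h i}"
    unfolding run_eq_iff by (auto simp: space_PiM valid_market_shock_dist[OF M])
  show "{\<omega>. run M \<omega> (length h) = h} \<in> sets (\<Pi>\<^sub>M n\<in>UNIV. ?S)"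
    unfolding run using ev by measurable
  have "emeasure (\<Pi>\<^sub>M n\<in>UNIV. ?S) {\<omega>. run M \<omega> (length h) = h} =
      (\<Prod>i<length h. emeasure ?S (round_events M h i))"
    unfolding run using ev by (intro emeasure_PiM_Collect) auto
  also have "\<dots> = lik M h (true_param M)"
  proof (induction h)
    case (Cons x h)
    have "(\<Prod>i<length h. emeasure ?S (round_events M (x # h) i)) = (\<Prod>i<length h. emeasure ?S (round_events M h i))"
      by (intro prod.cong) auto
    then show ?case using Cons
      by (simp add: posterior_def[symmetric] valid_market_shock_dist[OF M])
  qed simp
  finally show "emeasure (\<Pi>\<^sub>M n\<in>UNIV. ?S) {\<omega>. run M \<omega> (length h) = h} = lik M h (true_param M)" .
qed

lemma measurable_history:
  assumes M: "valid_market M"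
  shows "history M \<in> (\<Pi>\<^sub>M n\<in>UNIV. shock_dist M (true_param M)) \<rightarrow>\<^sub>M (\<Pi>\<^sub>M n\<in>UNIV. count_space UNIV)"
  using sets_run_event[OF M]
  by (intro measurable_history_process) (simp add: past_history space_PiM valid_market_shock_dist[OF M])

lemma
  assumes M: "valid_market M"
  shows prob_space_history_law: "prob_space (history_law M)"
    and sets_history_law [simp]: "sets (history_law M) = sets (\<Pi>\<^sub>M n\<in>UNIV. count_space UNIV)"
    and emeasure_history_law: "emeasure (history_law M) {X. past X (length h) = h} = lik M h (true_param M)"
proof -
  let ?N = "\<Pi>\<^sub>M n\<in>(UNIV::nat set). shock_dist M (true_param M)"
  interpret product_prob_space "\<lambda>_. shock_dist M (true_param M)" "UNIV :: nat set"
    by (rule product_prob_spaceI) (rule valid_market_shock_dist[OF M])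
  show "prob_space (history_law M)"
    unfolding history_law_def by (rule prob_space_distr[OF measurable_history[OF M]])
  show "sets (history_law M) = sets (\<Pi>\<^sub>M n\<in>UNIV. count_space UNIV)"
    by (simp add: history_law_def)
  have "emeasure (history_law M) {X. past X (length h) = h} =
      emeasure ?N {\<omega>. run M \<omega> (length h) = h}"
    unfolding history_law_def
    by (subst emeasure_distr[OF measurable_history[OF M] sets_past_event])
       (auto simp: past_history space_PiM valid_market_shock_dist[OF M] vimage_def)
  then show "emeasure (history_law M) {X. past X (length h) = h} = lik M h (true_param M)"
    by (simp add: emeasure_run_event[OF M])
qed

text \<open>A finite history occurs with probability equal to its own likelihood, and there are only
  countably many, so all those of likelihood 0 are avoided at once.\<close>

lemma AE_lik_pos:
  assumes M: "valid_market M"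
  shows "AE X in history_law M. \<forall>n. lik M (past X n) (true_param M) \<noteq> 0"
proof -
  interpret prob_space "history_law M" by (rule prob_space_history_law[OF M])
  have sp: "space (history_law M) = UNIV"
    by (simp add: history_law_def space_PiM)
  have "AE X in history_law M. \<forall>h. lik M h (true_param M) = 0 \<longrightarrow> past X (length h) \<noteq> h"
    unfolding AE_all_countable
  proof (intro allI)
    fix h
    show "AE X in history_law M. lik M h (true_param M) = 0 \<longrightarrow> past X (length h) \<noteq> h"
    proof (cases "lik M h (true_param M) = 0")
      case True
      moreover have "{X. past X (length h) = h} \<in> sets (history_law M)"
        unfolding sets_history_law[OF M] by (rule sets_past_event)
      ultimately have "{X. past X (length h) = h} \<in> null_sets (history_law M)"
        by (simp add: null_sets_def emeasure_history_law[OF M])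
      then show ?thesis by (auto simp: eventually_ae_filter sp)
    qed simp
  qed
  then show ?thesis by eventually_elim force
qed

text \<open>Missing \<open>D\<close> in \<open>m\<close> consecutive draws has probability
  \<open>q ^ m\<close> with \<open>q < 1\<close>, which tends to 0 whatever the starting round
  \<open>n0\<close>.\<close>

lemma AE_iid_infinitely_often:
  assumes "prob_space S" and D: "D \<in> sets S" "emeasure S D \<noteq> 0"
  shows "AE \<omega> in (\<Pi>\<^sub>M n\<in>(UNIV::nat set). S). \<forall>n0. \<exists>n\<ge>n0. \<omega> n \<in> D"
  unfolding AE_all_countable
proof
  fix n0 :: nat
  interpret S: prob_space S by fact
  interpret product_prob_space "\<lambda>_. S" "UNIV :: nat set"
    by (rule product_prob_spaceI) (rule assms)
  let ?N = "\<Pi>\<^sub>M n\<in>(UNIV::nat set). S"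
  define q where "q = S.prob (space S - D)"
  have "0 < S.prob D" using D(2) by (simp add: S.emeasure_eq_measure zero_less_measure_iff)
  then have q: "0 \<le> q" "q < 1"
    using S.prob_compl[OF D(1)] by (simp_all add: q_def)
  define D' where "D' = space S - D"
  have [measurable]: "D' \<in> sets S" using D(1) by (simp add: D'_def)
  let ?E = "{\<omega> \<in> space ?N. \<forall>n. n0 \<le> n \<longrightarrow> \<omega> n \<in> D'}"
  have E: "?E \<in> sets ?N"
    by measurable
  have le: "emeasure ?N ?E \<le> ennreal (q ^ m)" for m
  proof -
    have "emeasure ?N ?E \<le> emeasure ?N {\<omega> \<in> space ?N. \<forall>n\<in>{n0..<n0+m}. \<omega> n \<in> D'}"
      by (intro emeasure_mono) auto
    also have "\<dots> = (\<Prod>n\<in>{n0..<n0+m}. emeasure S D')"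
      by (intro emeasure_PiM_Collect) auto
    also have "\<dots> = ennreal (q ^ m)"
      by (simp add: q_def D'_def S.emeasure_eq_measure ennreal_power)
    finally show ?thesis .
  qed
  have "(\<lambda>m. ennreal (q ^ m)) \<longlonglongrightarrow> ennreal 0"
    using q by (intro tendsto_ennrealI LIMSEQ_realpow_zero)
  then have "emeasure ?N ?E \<le> ennreal 0"
    using le by (intro LIMSEQ_le_const) blast+
  then have "?E \<in> null_sets ?N" using E by (simp add: null_sets_def)
  then have "AE \<omega> in ?N. \<omega> \<notin> ?E" by (rule AE_not_in)
  with AE_space[of ?N] show "AE \<omega> in ?N. \<exists>n\<ge>n0. \<omega> n \<in> D"
    by eventually_elim (auto simp: space_PiM D'_def)
qed

text \<open>The index at a stage \<open>L\<close> of the record of \<open>j\<close>, detached from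
  any history. It agrees with \<open>index\<close> on histories of positive likelihood.\<close>

definition record_index :: "'b market \<Rightarrow> 'b \<Rightarrow> (bool \<times> bool) list \<Rightarrow> real \<Rightarrow> real" where
  "record_index M j L v =
     v * (\<integral>x. x \<partial>tilted (prior_qual M j) (qual_lik L)) - price M j
     - search_cost M / (\<integral>x. x \<partial>tilted (prior_fit M j) (fit_lik L))"

lemma index_eq_record_index:
  assumes "valid_market M" "lik M h (true_param M) \<noteq> 0"
  shows "index M (posterior M h) v j = record_index M j (records j h) v"
  using assms by (simp add: index_posterior record_index_def posterior_marginals)

definition attractive :: "'b market \<Rightarrow> 'b \<Rightarrow> (bool \<times> bool) list \<Rightarrow> bool" where
  "attractive M j L \<longleftrightarrow> emeasure (val_dist M) {v. 0 < record_index M j L v} \<noteq> 0"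

lemma sets_record_index [simp]:
  "valid_market M \<Longrightarrow> {v. 0 < record_index M j L v} \<in> sets (val_dist M)"
  unfolding record_index_def valid_market_val_dist by measurable

text \<open>A consumer meeting no fit at all inspects every business of positive index.\<close>

lemma AE_attractive_inspected_again:
  fixes M :: "('b::finite) market"
  assumes M: "valid_market M"
  shows "AE X in history_law M. \<forall>j L n0. attractive M j L \<longrightarrow> records j (past X n0) = L \<longrightarrow>
    (\<exists>n\<ge>n0. records j (past X n) \<noteq> L)"
proof -
  let ?S = "shock_dist M (true_param M)"
  let ?N = "\<Pi>\<^sub>M n\<in>(UNIV::nat set). ?S"
  \<comment> \<open>This event mentions only the stage \<open>L\<close>, not the round or the rest
    of the history; therefore it is the same set in every round spent at that stage and recurrence
    of i.i.d. draws applies.\<close>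
  define D where "D j L = {v. 0 < record_index M j L v} \<times> {w::'b \<Rightarrow> bool \<times> bool. \<forall>k. \<not> fst (w k)}" for j L
  let ?P = "\<lambda>j. pair_pmf (bernoulli_pmf (fit_prob M j)) (bernoulli_pmf (quality M j))"
  have D: "D j L \<in> sets ?S" for j L
    unfolding D_def shock_dist_def by (intro pair_measureI sets_record_index[OF M]) simp
  have D_pos: "emeasure ?S (D j L) \<noteq> 0" if "attractive M j L" for j L
  proof -
    \<comment> \<open>The absence of any fit is expressed as agreement with the record in which all
      businesses are inspected and none fits, so that the product formula for \<open>agrees\<close>
      can be used.\<close>
    have "emeasure (measure_pmf (Pi_pmf UNIV (False, False) ?P)) {w. \<forall>k. \<not> fst (w k)} =
        emeasure (measure_pmf (Pi_pmf UNIV (False, False) ?P)) {w. agrees (\<lambda>_. Some False, None) w}"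
      by (intro arg_cong2[where f = emeasure] refl) (auto simp: agrees_def revealed_def reveal_def)
    also have "\<dots> = (\<Prod>j\<in>UNIV. ennreal (1 - fit_prob M j))"
      unfolding emeasure_agrees
    proof (intro prod.cong refl, simp add: revealed_def, subst emeasure_reveal)
      fix j
      show "ennreal (pmf (bernoulli_pmf (fit_prob M j)) (fst (False, False))) *
          ennreal (if fst (False, False) then pmf (bernoulli_pmf (quality M j)) (snd (False, False)) else 1) =
        ennreal (1 - fit_prob M j)"
        using M by (simp add: valid_market_def less_imp_le)
    qed (simp add: reveal_def)
    also have "\<dots> \<noteq> 0"
      using M by (auto simp: valid_market_def ennreal_eq_0_iff not_le)
    finally have "emeasure (measure_pmf (Pi_pmf UNIV (False, False) ?P)) {w. \<forall>k. \<not> fst (w k)} \<noteq> 0" .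
    moreover have "emeasure ?S (D j L) = emeasure (val_dist M) {v. 0 < record_index M j L v} *
        emeasure (measure_pmf (Pi_pmf UNIV (False, False) ?P)) {w. \<forall>k. \<not> fst (w k)}"
      unfolding shock_dist_def true_param_def D_def fst_conv snd_conv
      by (intro measure_pmf.emeasure_pair_measure_Times sets_record_index[OF M]) simp
    ultimately show ?thesis using that by (simp add: attractive_def)
  qed
  have io: "AE \<omega> in ?N. \<forall>j L. attractive M j L \<longrightarrow> (\<forall>n0. \<exists>n\<ge>n0. \<omega> n \<in> D j L)"
    unfolding AE_all_countable
  proof (intro allI)
    fix j L
    show "AE \<omega> in ?N. attractive M j L \<longrightarrow> (\<forall>n0. \<exists>n\<ge>n0. \<omega> n \<in> D j L)"
      using AE_iid_infinitely_often[OF valid_market_shock_dist(1)[OF M] D D_pos, of j L]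
      by (cases "attractive M j L") auto
  qed
  have "AE \<omega> in ?N. \<forall>n. lik M (past (history M \<omega>) n) (true_param M) \<noteq> 0"
    using AE_lik_pos[OF M] unfolding history_law_def by (rule AE_distrD[OF measurable_history[OF M]])
  with io have "AE \<omega> in ?N. \<forall>j L n0. attractive M j L \<longrightarrow> records j (past (history M \<omega>) n0) = L \<longrightarrow>
    (\<exists>n\<ge>n0. records j (past (history M \<omega>) n) \<noteq> L)"
  proof eventually_elim
    case (elim \<omega>)
    show ?case
    proof (intro allI impI, rule ccontr)
      fix j L n0
      assume L: "attractive M j L" and "\<not> (\<exists>n\<ge>n0. records j (past (history M \<omega>) n) \<noteq> L)"
      then have const: "records j (run M \<omega> n) = L" if "n0 \<le> n" for n
        using that by (auto simp: past_history)
      from elim(1) L obtain n where n: "n0 \<le> n" "\<omega> n \<in> D j L" by blast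
      have "index M (posterior M (run M \<omega> n)) (fst (\<omega> n)) j = record_index M j L (fst (\<omega> n))"
        using index_eq_record_index[OF M, of "run M \<omega> n"] elim(2) const[OF n(1)] by (simp add: past_history)
      then have "inspects (index M (posterior M (run M \<omega> n)) (fst (\<omega> n))) (tie_rank M (run M \<omega> n) (fst (\<omega> n)))
          (fst \<circ> snd (\<omega> n)) j"
        using n(2) by (auto simp: inspects_def D_def)
      then have "records j (run M \<omega> (Suc n)) = reveal (snd (\<omega> n) j) # records j (run M \<omega> n)"
        by (simp add: round_obs_def revealed_observe[OF valid_market_tie_rank(1)[OF M]])
      then show False using const[of n] const[of "Suc n"] n(1) by simp
    qed
  qed
  moreover have "{X \<in> space (\<Pi>\<^sub>M n\<in>(UNIV::nat set). count_space (UNIV :: 'b obs set)). \<forall>j L n0. attractive M j L \<longrightarrow> records j (past X n0) = L \<longrightarrow>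
    (\<exists>n\<ge>n0. records j (past X n) \<noteq> L)} \<in> sets (\<Pi>\<^sub>M n\<in>UNIV. count_space UNIV)"
  proof -
    have [measurable]: "Measurable.pred (\<Pi>\<^sub>M n\<in>(UNIV::nat set). count_space (UNIV :: 'b obs set)) (\<lambda>X. records j (past X n) = L)" for j n L
      by (rule measurable_compose[OF measurable_past measurable_count_space])
    show ?thesis by measurable
  qed
  ultimately show ?thesis
    unfolding history_law_def by (subst AE_distr_iff[OF measurable_history[OF M]])
qed

section \<open>Coupling\<close>

text \<open>
  The coupling: the \<open>k\<close>-th inspection of business \<open>j\<close> reveals entry \<open>(j, k)\<close> of a table
  that is shared by all markets with the same parameters.
\<close>

definition table_dist :: "('b::finite) market \<Rightarrow> ((nat \<Rightarrow> real) \<times> ('b \<times> nat \<Rightarrow> bool \<times> bool)) measure" where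
  "table_dist M = (\<Pi>\<^sub>M n\<in>UNIV. val_dist M) \<Otimes>\<^sub>M
     (\<Pi>\<^sub>M s\<in>UNIV. measure_pmf (pair_pmf (bernoulli_pmf (fit_prob M (fst s))) (bernoulli_pmf (quality M (fst s)))))"

text \<open>The number of past inspections of \<open>j\<close> is the next unread entry of its row,
  counted from 0. An entry offered in a round without an inspection of \<open>j\<close> stays unread
  and is offered again.\<close>

primrec table_run :: "('b::finite) market \<Rightarrow> (nat \<Rightarrow> real) \<times> ('b \<times> nat \<Rightarrow> bool \<times> bool) \<Rightarrow> nat \<Rightarrow> 'b hist" where
  "table_run M \<omega> 0 = []"
| "table_run M \<omega> (Suc n) = round_obs M (table_run M \<omega> n) (posterior M (table_run M \<omega> n))
     (fst \<omega> n, \<lambda>j. snd \<omega> (j, length (records j (table_run M \<omega> n)))) # table_run M \<omega> n"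

definition table_history :: "('b::finite) market \<Rightarrow> (nat \<Rightarrow> real) \<times> ('b \<times> nat \<Rightarrow> bool \<times> bool) \<Rightarrow> nat \<Rightarrow> 'b obs" where
  "table_history M \<omega> n = hd (table_run M \<omega> (Suc n))"

lemma past_table_history: "past (table_history M \<omega>) n = table_run M \<omega> n"
  by (induction n) (simp_all add: table_history_def)

lemma records_table_run:
  assumes "valid_market M"
  shows "records j (table_run M \<omega> n) =
    rev (map (\<lambda>k. reveal (snd \<omega> (j, k))) [0..<length (records j (table_run M \<omega> n))])"
proof (induction n)
  case (Suc n)
  then show ?case
    by (simp add: round_obs_def revealed_observe[OF valid_market_tie_rank(1)[OF assms]])
qed simp

primrec value_sets :: "('b::finite) market \<Rightarrow> 'b hist \<Rightarrow> nat \<Rightarrow> real set" where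
  "value_sets M [] i = UNIV"
| "value_sets M (x # h) i = (if i = length h then values_for M h x else value_sets M h i)"

text \<open>Each inspection consumes a new entry, so a history constrains every table entry at most
  once and the event that it occurs is again a box.\<close>

lemma table_run_eq_iff:
  assumes M: "valid_market M"
  shows "table_run M \<omega> (length h) = h \<longleftrightarrow>
    (\<forall>i<length h. fst \<omega> i \<in> value_sets M h i) \<and>
    (\<forall>j. \<forall>k<length (records j h). reveal (snd \<omega> (j, k)) = rev (records j h) ! k)"
proof (induction h)
  case (Cons x h)
  have rec: "(\<forall>k<length (records j (x # h)). reveal (snd \<omega> (j, k)) = rev (records j (x # h)) ! k) \<longleftrightarrow>
    (\<forall>k<length (records j h). reveal (snd \<omega> (j, k)) = rev (records j h) ! k) \<and>
    (\<forall>y. revealed j x = Some y \<longrightarrow> reveal (snd \<omega> (j, length (records j h))) = y)" for j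
    by (cases "revealed j x") (auto simp: nth_append less_Suc_eq)
  have "table_run M \<omega> (length (x # h)) = x # h \<longleftrightarrow> table_run M \<omega> (length h) = h \<and>
      fst \<omega> (length h) \<in> values_for M h x \<and> agrees x (\<lambda>j. snd \<omega> (j, length (records j h)))"
    by (auto simp: round_obs_eq_iff[OF M])
  then show ?case
    unfolding Cons.IH rec agrees_def by (auto simp: less_Suc_eq)
qed simp

lemma prod_nth_rev: "(\<Prod>k<length L. f (rev L ! k)) = (\<Prod>y\<leftarrow>L. f y)"
  for f :: "'a \<Rightarrow> 'c::comm_monoid_mult"
proof -
  have "(\<Prod>y\<leftarrow>L. f y) = (\<Prod>y\<leftarrow>rev L. f y)" by (simp add: rev_map[symmetric] prod_list.rev)
  also have "\<dots> = (\<Prod>k<length L. f (rev L ! k))"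
    by (simp add: prod.list_conv_set_nth atLeast0LessThan)
  finally show ?thesis ..
qed

lemma prod_list_reveal:
  assumes "\<And>y. y \<in> set L \<Longrightarrow> reveal y = y"
  shows "(\<Prod>y\<leftarrow>L. emeasure (measure_pmf (pair_pmf (bernoulli_pmf p) (bernoulli_pmf q))) {w. reveal w = y}) =
    ennreal (fit_lik L p) * ennreal (qual_lik L q)"
  using assms
proof (induction L)
  case (Cons y L)
  have IH: "(\<Prod>y\<leftarrow>L. emeasure (measure_pmf (pair_pmf (bernoulli_pmf p) (bernoulli_pmf q))) {w. reveal w = y}) =
    ennreal (fit_lik L p) * ennreal (qual_lik L q)"
    using Cons by simp
  have "fit_lik (y # L) p = pmf (bernoulli_pmf p) (fst y) * fit_lik L p"
    "qual_lik (y # L) q = (if fst y then pmf (bernoulli_pmf q) (snd y) else 1) * qual_lik L q"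
    by (simp_all add: fit_lik_def qual_lik_def)
  then show ?case
    using emeasure_reveal[of y "bernoulli_pmf p" "bernoulli_pmf q"] Cons.prems[of y]
    by (simp add: IH ennreal_mult fit_lik_nonneg qual_lik_nonneg mult_ac)
qed (simp add: fit_lik_def qual_lik_def)

text \<open>The finitely many entries in \<open>slots\<close> are those read in the course of
  \<open>h\<close>. Their independent probabilities, grouped by business, give exactly the factors
  of the factorised likelihood.\<close>

lemma
  fixes M :: "('b::finite) market"
  assumes M: "valid_market M"
  shows prob_space_table_dist: "prob_space (table_dist M)"
    and space_table_dist: "space (table_dist M) = UNIV"
    and sets_table_run_event: "{\<omega>. table_run M \<omega> (length h) = h} \<in> sets (table_dist M)"
    and emeasure_table_run_event:
      "emeasure (table_dist M) {\<omega>. table_run M \<omega> (length h) = h} = lik M h (true_param M)"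
proof -
  define p where "p s = pair_pmf (bernoulli_pmf (fit_prob M (fst s))) (bernoulli_pmf (quality M (fst s)))"
    for s :: "'b \<times> nat"
  let ?V = "\<Pi>\<^sub>M n\<in>(UNIV::nat set). val_dist M" and ?T = "\<Pi>\<^sub>M s\<in>UNIV. measure_pmf (p s)"
  note D = valid_market_val_dist[OF M]
  interpret V: product_prob_space "\<lambda>_. val_dist M" "UNIV :: nat set"
    by (rule product_prob_spaceI) (rule D)
  interpret T: product_prob_space "\<lambda>s. measure_pmf (p s)" UNIV
    by (rule product_prob_spaceI) (rule measure_pmf.prob_space_axioms)
  have tab: "table_dist M = ?V \<Otimes>\<^sub>M ?T" unfolding table_dist_def p_def ..
  show "prob_space (table_dist M)"
    unfolding tab by (intro prob_space_pair V.prob_space_axioms T.prob_space_axioms)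
  show "space (table_dist M) = UNIV"
    unfolding tab by (simp add: space_pair_measure space_PiM D)
  define slots where "slots = (SIGMA j:UNIV. {..<length (records j h)})"
  define A where "A = {v \<in> space ?V. \<forall>i\<in>{..<length h}. v i \<in> value_sets M h i}"
  define B where "B = {t \<in> space ?T. \<forall>s\<in>slots. t s \<in> {w. reveal w = rev (records (fst s) h) ! snd s}}"
  have vs: "value_sets M h' i \<in> sets (val_dist M)" for h' i
    using D measurable_values_for[OF M] by (induction h') auto
  have [simp]: "finite slots" by (simp add: slots_def)
  have event: "{\<omega>. table_run M \<omega> (length h) = h} = A \<times> B"
    by (auto simp: table_run_eq_iff[OF M] A_def B_def slots_def space_PiM D)
  have A: "A \<in> sets ?V" unfolding A_def using vs by measurable
  have B: "B \<in> sets ?T" unfolding B_def by measurable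
  show "{\<omega>. table_run M \<omega> (length h) = h} \<in> sets (table_dist M)"
    unfolding event tab using A B by (rule pair_measureI)
  have eA: "emeasure ?V A = value_lik M h"
  proof -
    have "emeasure ?V A = (\<Prod>i<length h. emeasure (val_dist M) (value_sets M h i))"
      unfolding A_def using vs by (intro V.emeasure_PiM_Collect) auto
    also have "\<dots> = value_lik M h"
    proof (induction h)
      case (Cons x h)
      have "(\<Prod>i<length h. emeasure (val_dist M) (value_sets M (x # h) i)) =
          (\<Prod>i<length h. emeasure (val_dist M) (value_sets M h i))"
        by (intro prod.cong) auto
      then show ?case using Cons by simp
    qed simp
    finally show ?thesis .
  qed
  have "emeasure ?T B = (\<Prod>s\<in>slots. emeasure (measure_pmf (p s)) {w. reveal w = rev (records (fst s) h) ! snd s})"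
    unfolding B_def by (intro T.emeasure_PiM_Collect) auto
  also have "\<dots> = (\<Prod>j\<in>UNIV. \<Prod>k<length (records j h).
      emeasure (measure_pmf (pair_pmf (bernoulli_pmf (fit_prob M j)) (bernoulli_pmf (quality M j))))
        {w. reveal w = rev (records j h) ! k})"
    unfolding slots_def by (subst prod.Sigma) (auto simp: p_def case_prod_beta)
  also have "\<dots> = (\<Prod>j\<in>UNIV. ennreal (fit_lik (records j h) (fit_prob M j)) *
      ennreal (qual_lik (records j h) (quality M j)))"
    by (intro prod.cong refl, subst prod_nth_rev, rule prod_list_reveal, rule records_reveal)
  finally have eB: "emeasure ?T B = (\<Prod>j\<in>UNIV. ennreal (fit_lik (records j h) (fit_prob M j)) *
      ennreal (qual_lik (records j h) (quality M j)))" .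
  have "emeasure (table_dist M) {\<omega>. table_run M \<omega> (length h) = h} = emeasure ?V A * emeasure ?T B"
    unfolding event tab using A B by (rule T.emeasure_pair_measure_Times)
  also have "\<dots> = lik M h (true_param M)"
    unfolding eA eB lik_factorises[OF M] by (simp add: true_param_def prod.distrib)
  finally show "emeasure (table_dist M) {\<omega>. table_run M \<omega> (length h) = h} = lik M h (true_param M)" .
qed

lemma measurable_table_history:
  assumes M: "valid_market M"
  shows "table_history M \<in> table_dist M \<rightarrow>\<^sub>M (\<Pi>\<^sub>M n\<in>UNIV. count_space UNIV)"
  using sets_table_run_event[OF M]
  by (intro measurable_history_process) (simp add: past_table_history space_table_dist[OF M])

text \<open>Under both mechanisms a finite history has probability equal to its likelihood, so
  reading reused-until-inspected table entries produces the same law as drawing new shocks each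
  round.\<close>

lemma distr_table_history:
  assumes M: "valid_market M"
  shows "distr (table_dist M) (\<Pi>\<^sub>M n\<in>UNIV. count_space UNIV) (table_history M) = history_law M"
proof (rule measure_eqI_past)
  interpret prob_space "table_dist M" by (rule prob_space_table_dist[OF M])
  show "prob_space (distr (table_dist M) (\<Pi>\<^sub>M n\<in>UNIV. count_space UNIV) (table_history M))"
    by (rule prob_space_distr[OF measurable_table_history[OF M]])
  fix h
  show "emeasure (distr (table_dist M) (\<Pi>\<^sub>M n\<in>UNIV. count_space UNIV) (table_history M)) {X. past X (length h) = h} =
      emeasure (history_law M) {X. past X (length h) = h}"
    unfolding emeasure_history_law[OF M] emeasure_table_run_event[OF M, symmetric]
    by (subst emeasure_distr[OF measurable_table_history[OF M] sets_past_event])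
       (simp add: past_table_history space_table_dist[OF M] vimage_def)
qed (simp_all add: prob_space_history_law[OF M] sets_history_law[OF M])

definition comparable :: "'c list \<Rightarrow> 'c list \<Rightarrow> bool" where
  "comparable L L' \<longleftrightarrow> (\<exists>K. L' = K @ L) \<or> (\<exists>K. L = K @ L')"

lemma comparable_rev_map: "comparable (rev (map f [0..<m])) (rev (map f [0..<n]))"
proof -
  have "\<exists>K. rev (map f [0..<n]) = K @ rev (map f [0..<m])" if "m \<le> n" for m n
    using upt_add_eq_append[of 0 m "n - m"] that by simp
  then show ?thesis unfolding comparable_def by (meson nle_le)
qed

lemma history_coupling:
  fixes M M' :: "('b::finite) market"
  assumes M: "valid_market M" and M': "valid_market M'" and same: "table_dist M' = table_dist M"
  obtains K where "coupling K (history_law M) (history_law M')"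
    and "AE (X, X') in K. \<forall>j m n. comparable (records j (past X m)) (records j (past X' n))"
proof
  let ?C = "\<Pi>\<^sub>M n\<in>(UNIV::nat set). count_space (UNIV :: 'b obs set)"
  define f where "f \<omega> = (table_history M \<omega>, table_history M' \<omega>)" for \<omega>
  define K where "K = distr (table_dist M) (?C \<Otimes>\<^sub>M ?C) f"
  have t[measurable]: "table_history M \<in> table_dist M \<rightarrow>\<^sub>M ?C" "table_history M' \<in> table_dist M \<rightarrow>\<^sub>M ?C"
    using measurable_table_history[OF M] measurable_table_history[OF M'] by (simp_all add: same)
  have f[measurable]: "f \<in> table_dist M \<rightarrow>\<^sub>M ?C \<Otimes>\<^sub>M ?C"
    unfolding f_def by measurable
  note S = sets_history_law[OF M] sets_history_law[OF M']
  have "prob_space K"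
    unfolding K_def by (rule prob_space.prob_space_distr[OF prob_space_table_dist[OF M] f])
  moreover have "sets K = sets (history_law M \<Otimes>\<^sub>M history_law M')"
    unfolding K_def sets_distr by (rule sets_pair_measure_cong[OF S, symmetric])
  moreover have "distr K (history_law M) fst = history_law M"
  proof -
    have "distr K (history_law M) fst = distr K ?C fst"
      by (rule distr_cong) (simp_all add: S)
    also have "\<dots> = distr (table_dist M) ?C (table_history M)"
      unfolding K_def by (subst distr_distr) (auto simp: f_def comp_def)
    finally show ?thesis by (simp add: distr_table_history[OF M])
  qed
  moreover have "distr K (history_law M') snd = history_law M'"
  proof -
    have "distr K (history_law M') snd = distr K ?C snd"
      by (rule distr_cong) (simp_all add: S)
    also have "\<dots> = distr (table_dist M) ?C (table_history M')"
      unfolding K_def by (subst distr_distr) (auto simp: f_def comp_def)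
    finally show ?thesis using distr_table_history[OF M'] by (simp add: same)
  qed
  ultimately show "coupling K (history_law M) (history_law M')"
    by (simp add: coupling_def)
  \<comment> \<open>Quantifying over the possible pasts \<open>h\<close> and \<open>h'\<close> turns
    the property into a countable combination of cylinder events, which makes it measurable.\<close>
  define Q where "Q X X' \<longleftrightarrow> (\<forall>j m n h h'. past X m = h \<longrightarrow> past X' n = h' \<longrightarrow> comparable (records j h) (records j h'))"
    for X X' :: "nat \<Rightarrow> 'b obs"
  have "Measurable.pred (?C \<Otimes>\<^sub>M ?C) (\<lambda>x. Q (fst x) (snd x))"
  proof -
    have [measurable]: "Measurable.pred ?C (\<lambda>X. past X n = h)" for n h
      using sets_past_event[of n h] by (simp add: pred_def space_PiM)
    show ?thesis unfolding Q_def by measurable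
  qed
  moreover have "Q (fst (f \<omega>)) (snd (f \<omega>))" for \<omega>
    using comparable_rev_map records_table_run[OF M, symmetric] records_table_run[OF M', symmetric]
    by (metis (no_types, lifting) Q_def f_def fst_conv snd_conv past_table_history)
  ultimately have "AE x in K. Q (fst x) (snd x)"
    unfolding K_def by (subst AE_distr_iff[OF f]) (auto simp: pred_def)
  then show "AE (X, X') in K. \<forall>j m n. comparable (records j (past X m)) (records j (past X' n))"
    by eventually_elim (auto simp: Q_def)
qed

section \<open>Learning\<close>

lemma records_past_add: "\<exists>K. records j (past X (n + d)) = K @ records j (past X n)"
proof (induction d)
  case (Suc d)
  then show ?case by (auto split: option.split)
qed simp

lemma length_records_mono: "m \<le> n \<Longrightarrow> length (records j (past X m)) \<le> length (records j (past X n))"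
  using records_past_add[of j X m "n - m"] by auto

lemma length_records_Suc_le: "length (records j (past X (Suc n))) \<le> Suc (length (records j (past X n)))"
  by (auto split: option.split)

lemma records_past_eqI:
  assumes "length (records j (past X m)) = length (records j (past X n))"
  shows "records j (past X m) = records j (past X n)"
  using assms records_past_add[of j X m "n - m"] records_past_add[of j X n "m - n"]
  by (cases "m \<le> n") auto

text \<open>A discrete intermediate value argument: the record is empty at the start and grows by at
  most one entry per round.\<close>

lemma length_records_surj:
  assumes "k \<le> length (records j (past X n))"
  shows "\<exists>m\<le>n. length (records j (past X m)) = k"
  using assms
proof (induction n)
  case (Suc n)
  show ?case
  proof (cases "k \<le> length (records j (past X n))")
    case True
    with Suc.IH show ?thesis using le_SucI by blast
  next
    case False
    then have "k = length (records j (past X (Suc n)))"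
      using Suc.prems length_records_Suc_le[of j X n] by linarith
    then show ?thesis by blast
  qed
qed simp

lemma comparable_length_eq: "comparable L L' \<Longrightarrow> length L = length L' \<Longrightarrow> L = L'"
  by (auto simp: comparable_def)

text \<open>
  Either the records of \<open>X\<close> stop growing, and \<open>\<phi>\<close> already vanishes there, or they run
  through every later stage of the records of \<open>X'\<close>.
\<close>

lemma tendsto_0_along_records:
  fixes \<phi> :: "(bool \<times> bool) list \<Rightarrow> real"
  assumes comp: "\<And>m n. comparable (records j (past X m)) (records j (past X' n))"
    and dom: "\<And>m. \<exists>n. length (records j (past X m)) \<le> length (records j (past X' n))"
    and zero: "\<And>K L. \<phi> L = 0 \<Longrightarrow> \<phi> (K @ L) = 0"
    and lim: "(\<lambda>n. \<phi> (records j (past X n))) \<longlonglongrightarrow> 0"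
  shows "(\<lambda>n. \<phi> (records j (past X' n))) \<longlonglongrightarrow> 0"
proof (rule LIMSEQ_I)
  fix e :: real assume e: "0 < e"
  let ?r = "\<lambda>n. records j (past X n)" and ?r' = "\<lambda>n. records j (past X' n)"
  obtain m0 where m0: "\<And>m. m0 \<le> m \<Longrightarrow> norm (\<phi> (?r m)) < e"
    using LIMSEQ_D[OF lim e] by auto
  obtain n0 where n0: "length (?r m0) \<le> length (?r' n0)" using dom by blast
  have "norm (\<phi> (?r' n)) < e" if n: "n0 \<le> n" for n
  proof (cases "\<exists>m. length (?r' n) \<le> length (?r m)")
    case True
    then obtain m1 where "length (?r' n) \<le> length (?r m1)" by blast
    from length_records_surj[OF this] obtain m where m: "length (?r m) = length (?r' n)" by blast
    \<comment> \<open>The index \<open>m\<close> may be too early for the bound from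
      \<open>m0\<close>. In that case the stages at \<open>m\<close> and \<open>m0\<close> are
      squeezed to the same length, because \<open>X'\<close> has already passed the stage of
      \<open>m0\<close>.\<close>
    have "?r' n = ?r (max m m0)"
    proof (rule comparable_length_eq[OF comp, symmetric])
      show "length (?r (max m m0)) = length (?r' n)"
        using m n0 length_records_mono[OF n, of j X'] length_records_mono[of m m0 j X]
        by (cases "m \<le> m0") (simp_all add: max_def)
    qed
    then show ?thesis using m0[of "max m m0"] by simp
  next
    case False
    then have "length (?r m) < Suc (length (?r' n))" for m
      by (simp add: not_le less_Suc_eq_le less_imp_le)
    then obtain m1 where m1: "\<And>m. length (?r m) \<le> length (?r m1)"
      using ex_has_greatest_nat[of "\<lambda>_. True" 0 "\<lambda>m. length (?r m)" "Suc (length (?r' n))"] by blast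
    have "?r m = ?r m1" if "m1 \<le> m" for m
      by (rule records_past_eqI) (rule le_antisym[OF m1 length_records_mono[OF that]])
    then have "\<forall>\<^sub>F m in sequentially. \<phi> (?r m) = \<phi> (?r m1)"
      unfolding eventually_sequentially by metis
    then have "(\<lambda>m. \<phi> (?r m)) \<longlonglongrightarrow> \<phi> (?r m1)"
      by (rule tendsto_eventually)
    \<comment> \<open>An eventually constant sequence with limit 0 has reached 0 itself, which is
      what \<open>zero\<close> can carry over to longer records.\<close>
    then have "\<phi> (?r m1) = 0" using lim by (rule LIMSEQ_unique)
    moreover have "\<exists>K. ?r' n = K @ ?r m1"
      using comp[of m1 n] False unfolding comparable_def by (metis le_add2 length_append)
    ultimately show ?thesis using zero e by auto
  qed
  then show "\<exists>n0. \<forall>n\<ge>n0. norm (\<phi> (?r' n) - 0) < e" by auto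
qed

text \<open>A smaller likelihood has a smaller unnormalised mass on \<open>S\<close>, and this is 0
  already for \<open>g\<close>. Should the normaliser of \<open>g'\<close> vanish, the quotient is
  still 0 in \<open>ennreal\<close>.\<close>

lemma tilted_null_mono:
  assumes \<mu>: "prob_space \<mu>" "sets \<mu> = sets borel" and S: "S \<in> sets borel"
    and g: "g \<in> borel_measurable borel" "g' \<in> borel_measurable borel"
    and le: "\<And>x. 0 \<le> g' x" "\<And>x. g' x \<le> g x" "\<And>x. g x \<le> 1"
    and null: "measure (tilted \<mu> g) S = 0"
  shows "measure (tilted \<mu> g') S = 0"
proof -
  interpret prob_space \<mu> by fact
  have "(\<integral>\<^sup>+x. ennreal (g x) \<partial>\<mu>) \<le> (\<integral>\<^sup>+x. 1 \<partial>\<mu>)"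
    using le by (intro nn_integral_mono) simp
  then have A: "(\<integral>\<^sup>+x. ennreal (g x) \<partial>\<mu>) < top"
    by (simp add: emeasure_space_1 order.strict_trans1)
  have I: "(\<integral>\<^sup>+x. ennreal (g x) * indicator S x \<partial>\<mu>) \<le> (\<integral>\<^sup>+x. ennreal (g x) \<partial>\<mu>)"
    by (intro nn_integral_mono) (auto simp: indicator_def)
  \<comment> \<open>Needed because \<open>measure\<close> also returns 0 where the extended mass is
    infinite.\<close>
  have "emeasure (tilted \<mu> g) S \<noteq> top"
    unfolding emeasure_tilted[OF \<mu>(2) g(1) S] using I A by (auto simp: ennreal_divide_eq_top_iff)
  then have "emeasure (tilted \<mu> g) S = 0"
    using null by (simp add: measure_def enn2real_eq_0_iff)
  then have "(\<integral>\<^sup>+x. ennreal (g x) * indicator S x \<partial>\<mu>) = 0"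
    unfolding emeasure_tilted[OF \<mu>(2) g(1) S] using A by auto
  moreover have "(\<integral>\<^sup>+x. ennreal (g' x) * indicator S x \<partial>\<mu>) \<le> (\<integral>\<^sup>+x. ennreal (g x) * indicator S x \<partial>\<mu>)"
    using le by (intro nn_integral_mono mult_right_mono ennreal_leI) auto
  ultimately show ?thesis
    by (simp add: measure_def emeasure_tilted[OF \<mu>(2) g(2) S])
qed

lemma concentrates_along_records:
  assumes \<mu>: "prob_space \<mu>" "sets \<mu> = sets borel"
    and g: "\<And>L. g L \<in> borel_measurable borel" "\<And>L x. 0 \<le> g L x" "\<And>L x. g L x \<le> 1"
      "\<And>K L x. g (K @ L) x \<le> g L x"
    and comp: "\<And>m n. comparable (records j (past X m)) (records j (past X' n))"
    and dom: "\<And>m. \<exists>n. length (records j (past X m)) \<le> length (records j (past X' n))"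
    and lim: "concentrates (\<lambda>n. tilted \<mu> (g (records j (past X n)))) a"
  shows "concentrates (\<lambda>n. tilted \<mu> (g (records j (past X' n)))) a"
  unfolding concentrates_def
proof (intro allI impI)
  fix \<epsilon> :: real assume \<epsilon>: "0 < \<epsilon>"
  let ?S = "{x. \<epsilon> < \<bar>x - a\<bar>}"
  show "(\<lambda>n. measure (tilted \<mu> (g (records j (past X' n)))) ?S) \<longlonglongrightarrow> 0"
  proof (rule tendsto_0_along_records[where \<phi> = "\<lambda>L. measure (tilted \<mu> (g L)) ?S", OF comp dom])
    show "measure (tilted \<mu> (g (K @ L))) ?S = 0" if "measure (tilted \<mu> (g L)) ?S = 0" for K L
      by (rule tilted_null_mono[OF \<mu> _ g(1) g(1) g(2) g(4) g(3) that]) simp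
    show "(\<lambda>n. measure (tilted \<mu> (g (records j (past X n)))) ?S) \<longlonglongrightarrow> 0"
      using lim \<epsilon> by (simp add: concentrates_def)
  qed
qed

section \<open>Inspection and learning under two search costs\<close>

lemma attractive_mono:
  assumes M: "valid_market M" and M': "valid_market (M\<lparr>search_cost := c'\<rparr>)"
    and c': "c' \<le> search_cost M" and "attractive M j L"
  shows "attractive (M\<lparr>search_cost := c'\<rparr>) j L"
proof -
  have "AE x in prior_fit M j. 0 < x \<and> x < 1" using M by (simp add: valid_market_def)
  then have "AE x in tilted (prior_fit M j) (fit_lik L). 0 \<le> x"
    unfolding tilted_def
    by (subst AE_density) (auto simp: measurable_cong_sets[OF valid_market_priors(2)[OF M] refl])
  \<comment> \<open>The sign of the expected fit probability makes the index antitone in the cost;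
    if that mean were 0, the cost term would be 0 under either cost.\<close>
  then have "0 \<le> (\<integral>x. x \<partial>tilted (prior_fit M j) (fit_lik L))"
    by (rule integral_nonneg_AE)
  then have "record_index M j L v \<le> record_index (M\<lparr>search_cost := c'\<rparr>) j L v" for v
    using c' by (simp add: record_index_def divide_right_mono)
  then have "{v. 0 < record_index M j L v} \<subseteq> {v. 0 < record_index (M\<lparr>search_cost := c'\<rparr>) j L v}"
    by (auto intro: less_le_trans)
  then have "emeasure (val_dist M) {v. 0 < record_index M j L v} \<le>
      emeasure (val_dist M) {v. 0 < record_index (M\<lparr>search_cost := c'\<rparr>) j L v}"
    using sets_record_index[OF M'] by (intro emeasure_mono) auto
  with assms(4) show ?thesis by (auto simp: attractive_def)
qed

text \<open>A round of positive likelihood arises from a non-null set of values, and each of these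
  values makes the index of the inspected \<open>j\<close> positive.\<close>

lemma attractive_if_inspected:
  assumes M: "valid_market M"
    and pos: "lik M h (true_param M) \<noteq> 0" "lik M (x # h) (true_param M) \<noteq> 0"
    and x: "revealed j x \<noteq> None"
  shows "attractive M j (records j h)"
proof -
  have "emeasure (val_dist M) (values_for M h x) \<noteq> 0"
    using pos(2) unfolding lik_factorises[OF M] by auto
  moreover have "values_for M h x \<subseteq> {v. 0 < record_index M j (records j h) v}"
  proof
    fix v assume "v \<in> values_for M h x"
    then obtain w where "round_obs M h (posterior M h) (v, w) = x" by (auto simp: values_for_def)
    then have "inspects (index M (posterior M h) v) (tie_rank M h v) (fst \<circ> w) j"
      using x by (auto simp: round_obs_def revealed_observe[OF valid_market_tie_rank(1)[OF M]] split: if_splits)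
    then show "v \<in> {v. 0 < record_index M j (records j h) v}"
      by (simp add: inspects_def index_eq_record_index[OF M pos(1)])
  qed
  then have "emeasure (val_dist M) (values_for M h x) \<le> emeasure (val_dist M) {v. 0 < record_index M j (records j h) v}"
    using sets_record_index[OF M] by (intro emeasure_mono)
  ultimately show ?thesis by (auto simp: attractive_def)
qed

text \<open>Induction over the rounds of \<open>X\<close>. The only critical case is an inspection
  in \<open>X\<close> that would put it ahead: then both records are at the same stage, hence equal,
  that stage is attractive under the lower cost as well, and \<open>X'\<close> leaves it at a later
  round.\<close>

lemma records_dominated:
  assumes M: "valid_market M" and M': "valid_market (M\<lparr>search_cost := c'\<rparr>)"
    and c': "c' \<le> search_cost M"
    and pos: "\<And>n. lik M (past X n) (true_param M) \<noteq> 0"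
    and again: "\<And>L n0. attractive (M\<lparr>search_cost := c'\<rparr>) j L \<Longrightarrow> records j (past X' n0) = L \<Longrightarrow>
      \<exists>n\<ge>n0. records j (past X' n) \<noteq> L"
    and comp: "\<And>m n. comparable (records j (past X m)) (records j (past X' n))"
  shows "\<exists>n. length (records j (past X m)) \<le> length (records j (past X' n))"
proof (induction m)
  case (Suc m)
  then obtain n where n: "length (records j (past X m)) \<le> length (records j (past X' n))" by auto
  show ?case
  proof (cases "length (records j (past X (Suc m))) \<le> length (records j (past X' n))")
    case False
    then have ins: "revealed j (X m) \<noteq> None" using n by (auto split: option.splits)
    have "length (records j (past X m)) = length (records j (past X' n))"
      using False n length_records_Suc_le[of j X m] by simp
    then have eq: "records j (past X' n) = records j (past X m)"
      using comparable_length_eq[OF comp] by metis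
    have "attractive (M\<lparr>search_cost := c'\<rparr>) j (records j (past X' n))"
      unfolding eq using attractive_if_inspected[OF M pos[of m] _ ins] pos[of "Suc m"]
      by (intro attractive_mono[OF M M' c']) simp
    from again[OF this refl] obtain n' where n': "n \<le> n'" "records j (past X' n') \<noteq> records j (past X' n)"
      by blast
    then have "length (records j (past X' n)) < length (records j (past X' n'))"
      using length_records_mono[OF n'(1)] records_past_eqI[of j X' n' n] by (metis le_neq_implies_less)
    then show ?thesis using eq length_records_Suc_le[of j X m] by (metis Suc_leI order_trans)
  qed auto
qed auto

lemma learned_mono:
  assumes M: "valid_market M" and M': "valid_market (M\<lparr>search_cost := c'\<rparr>)"
    and c': "c' \<le> search_cost M"
    and pos: "\<And>n. lik M (past X n) (true_param M) \<noteq> 0"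
    and pos': "\<And>n. lik (M\<lparr>search_cost := c'\<rparr>) (past X' n) (true_param M) \<noteq> 0"
    and again: "\<And>j L n0. attractive (M\<lparr>search_cost := c'\<rparr>) j L \<Longrightarrow> records j (past X' n0) = L \<Longrightarrow>
      \<exists>n\<ge>n0. records j (past X' n) \<noteq> L"
    and comp: "\<And>j m n. comparable (records j (past X m)) (records j (past X' n))"
  shows "learned M X \<subseteq> learned (M\<lparr>search_cost := c'\<rparr>) X'"
proof
  let ?M' = "M\<lparr>search_cost := c'\<rparr>"
  fix j assume j: "j \<in> learned M X"
  note P = valid_market_priors[OF M]
  have dom: "\<exists>n. length (records j (past X m)) \<le> length (records j (past X' n))" for m
    by (rule records_dominated[OF M M' c' pos again comp])
  have post: "post_fit M (past X n) j = tilted (prior_fit M j) (fit_lik (records j (past X n)))"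
    "post_qual M (past X n) j = tilted (prior_qual M j) (qual_lik (records j (past X n)))" for n
    by (rule posterior_marginals[OF M pos])+
  have post': "post_fit ?M' (past X' n) j = tilted (prior_fit M j) (fit_lik (records j (past X' n)))"
    "post_qual ?M' (past X' n) j = tilted (prior_qual M j) (qual_lik (records j (past X' n)))" for n
    using posterior_marginals[OF M', of "past X' n" j] pos'[of n] by (simp_all add: true_param_def)
  have fit: "concentrates (\<lambda>n. post_fit M (past X n) j) (fit_prob M j)"
    and qual: "concentrates (\<lambda>n. post_qual M (past X n) j) (quality M j)"
    using j by (auto simp: learned_def)
  have "concentrates (\<lambda>n. post_fit ?M' (past X' n) j) (fit_prob M j)"
    unfolding post'
  proof (rule concentrates_along_records[where g = fit_lik and X = X])
    show "concentrates (\<lambda>n. tilted (prior_fit M j) (fit_lik (records j (past X n)))) (fit_prob M j)"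
      using fit unfolding post .
  qed (fact P measurable_fit_lik fit_lik_nonneg fit_lik_le_1 fit_lik_append_le comp dom)+
  moreover have "concentrates (\<lambda>n. post_qual ?M' (past X' n) j) (quality M j)"
    unfolding post'
  proof (rule concentrates_along_records[where g = qual_lik and X = X])
    show "concentrates (\<lambda>n. tilted (prior_qual M j) (qual_lik (records j (past X n)))) (quality M j)"
      using qual unfolding post .
  qed (fact P measurable_qual_lik qual_lik_nonneg qual_lik_le_1 qual_lik_append_le comp dom)+
  ultimately show "j \<in> learned ?M' X'"
    by (simp add: learned_def)
qed

section \<open>Limit utility\<close>

text \<open>By the Lindelof property the union of all open null sets is a countable union of such
  sets, hence null. Applied to the values, it turns the maximum of the support into an almost sure
  bound.\<close>

lemma AE_msupport:
  assumes "sets \<mu> = sets borel"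
  shows "AE x in \<mu>. x \<in> msupport \<mu>"
proof -
  obtain \<F>' where \<F>': "\<F>' \<subseteq> {A. open A \<and> emeasure \<mu> A = 0}" "countable \<F>'"
    "\<Union>\<F>' = \<Union>{A. open A \<and> emeasure \<mu> A = 0}"
    using Lindelof[of "{A::real set. open A \<and> emeasure \<mu> A = 0}"] by blast
  have "(\<Union>A\<in>\<F>'. A) \<in> null_sets \<mu>"
  proof (rule null_sets_UN'[OF \<F>'(2)])
    fix A assume "A \<in> \<F>'"
    with \<F>'(1) assms show "A \<in> null_sets \<mu>" by (intro null_setsI) auto
  qed
  then have "AE x in \<mu>. x \<notin> \<Union>\<F>'" using AE_not_in[of "\<Union>\<F>'" \<mu>] by simp
  then show ?thesis
    unfolding \<F>'(3) by eventually_elim (auto simp: msupport_def zero_less_iff_neq_zero)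
qed

lemma AE_val_dist_bounded:
  assumes "valid_market M"
  obtains vmax where "AE v in val_dist M. 0 \<le> v \<and> v \<le> vmax"
proof -
  obtain vmax where "\<forall>v \<in> msupport (val_dist M). v \<le> vmax" and "AE v in val_dist M. 0 \<le> v"
    using assms by (auto simp: valid_market_def value_distribution_def)
  with AE_msupport[OF valid_market_val_dist(2)[OF assms]] have "AE v in val_dist M. 0 \<le> v \<and> v \<le> vmax"
    by auto
  then show thesis by (rule that)
qed

text \<open>With countably many plans, the utility of a policy is measurable in the value as soon as
  that of each fixed plan is.\<close>

instance plan :: (countable) countable
  by countable_datatype

lemma plan_util_cost_antimono:
  assumes M: "valid_market M" and "c' \<le> search_cost M"
  shows "plan_util M v p f \<le> plan_util (M\<lparr>search_cost := c'\<rparr>) v p f"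
proof (induction p arbitrary: f)
  case (Inspect j a b)
  have "0 \<le> 1 - fit_prob M j" "0 \<le> fit_prob M j"
    using M by (auto simp: valid_market_def less_imp_le)
  with Inspect assms(2) show ?case
    by (auto intro!: add_mono diff_mono mult_left_mono)
qed simp_all

lemma plan_util_le:
  assumes M: "valid_market M" and v: "0 \<le> v"
  shows "plan_util M v p f \<le> v"
proof (induction p arbitrary: f)
  case (Transact j)
  have "v * quality M j * of_bool (f j) \<le> v * 1 * 1"
    using M v by (intro mult_mono) (auto simp: valid_market_def)
  moreover have "0 \<le> price M j" using M by (simp add: valid_market_def)
  ultimately show ?case by simp
next
  case (Inspect j a b)
  have "0 \<le> 1 - fit_prob M j" "0 \<le> fit_prob M j" "0 \<le> search_cost M"
    using M by (auto simp: valid_market_def less_imp_le)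
  moreover have "(1 - fit_prob M j) * plan_util M v a (f(j := False)) +
      fit_prob M j * plan_util M v b (f(j := True)) \<le> (1 - fit_prob M j) * v + fit_prob M j * v"
    using calculation Inspect by (intro add_mono mult_left_mono) auto
  ultimately show ?case by (simp add: algebra_simps)
qed (simp add: v)

text \<open>The worst case pays for inspecting everything in \<open>S\<close> not yet inspected.
  Admissible plans never inspect a business twice, so each inspection lowers
  \<open>card (S - I)\<close> by one. The sum of all prices bounds the single price paid, uniformly
  over plans.\<close>

lemma plan_util_ge:
  fixes M :: "('b::finite) market"
  assumes M: "valid_market M" and v: "0 \<le> v"
  shows "admissible S p I \<Longrightarrow>
    - (\<Sum>j\<in>UNIV. price M j) - search_cost M * card (S - I) \<le> plan_util M v p f"
proof (induction p arbitrary: I f)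
  case Leave
  have "0 \<le> (\<Sum>j\<in>UNIV. price M j)" "0 \<le> search_cost M * card (S - I)"
    using M by (auto simp: valid_market_def intro: sum_nonneg)
  then show ?case by simp
next
  case (Transact j)
  have "price M j \<le> (\<Sum>j\<in>UNIV. price M j)"
    using M by (intro member_le_sum) (auto simp: valid_market_def)
  moreover have "0 \<le> search_cost M * card (S - I)" "0 \<le> v * quality M j * of_bool (f j)"
    using M v by (auto simp: valid_market_def)
  ultimately show ?case by simp
next
  case (Inspect j a b)
  define B where "B = - (\<Sum>j\<in>UNIV. price M j) - search_cost M * card (S - insert j I)"
  have j: "j \<in> S - I" and adm: "admissible S a (insert j I)" "admissible S b (insert j I)"
    using Inspect.prems by simp_all
  have "card (S - I) = Suc (card (S - insert j I))"
  proof -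
    have "S - I = insert j (S - insert j I)" using j by auto
    then show ?thesis by simp
  qed
  then have B: "- (\<Sum>j\<in>UNIV. price M j) - search_cost M * card (S - I) = B - search_cost M"
    by (simp add: B_def algebra_simps)
  have "0 \<le> 1 - fit_prob M j" "0 \<le> fit_prob M j"
    using M by (auto simp: valid_market_def less_imp_le)
  moreover have "B \<le> plan_util M v a (f(j := False))" "B \<le> plan_util M v b (f(j := True))"
    unfolding B_def by (rule Inspect.IH(1)[OF adm(1)], rule Inspect.IH(2)[OF adm(2)])
  ultimately have "(1 - fit_prob M j) * B + fit_prob M j * B \<le>
      (1 - fit_prob M j) * plan_util M v a (f(j := False)) + fit_prob M j * plan_util M v b (f(j := True))"
    by (intro add_mono mult_left_mono)
  then show ?case unfolding B by (simp add: algebra_simps)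
qed

lemma measurable_plan_util: "(\<lambda>v. plan_util M v p f) \<in> borel_measurable borel"
  by (induction p arbitrary: f) simp_all

lemma integrable_policy:
  fixes M :: "('b::finite) market"
  assumes M: "valid_market M" and p: "p \<in> policies S"
  shows "integrable (val_dist M) (\<lambda>v. plan_util M v (p v) f)"
proof -
  interpret prob_space "val_dist M" by (rule valid_market_val_dist[OF M])
  obtain vmax where vmax: "AE v in val_dist M. 0 \<le> v \<and> v \<le> vmax"
    by (rule AE_val_dist_bounded[OF M])
  define B where "B = (\<Sum>j\<in>UNIV. price M j) + search_cost M * card (S - {})"
  have "AE v in val_dist M. norm (plan_util M v (p v) f) \<le> \<bar>vmax\<bar> + \<bar>B\<bar>"
    using vmax
  proof eventually_elim
    case (elim v)
    have "admissible S (p v) {}" using p by (simp add: policies_def)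
    from plan_util_ge[OF M _ this, of v f] plan_util_le[OF M, of v "p v" f] elim
    show ?case by (auto simp: B_def)
  qed
  moreover have "(\<lambda>v. plan_util M v (p v) f) \<in> borel_measurable (val_dist M)"
  proof -
    have "p \<in> borel \<rightarrow>\<^sub>M count_space UNIV" using p by (simp add: policies_def)
    then have "(\<lambda>v. plan_util M v (p v) f) \<in> borel_measurable borel"
      by (rule measurable_compose_countable[where f = "\<lambda>a v. plan_util M v a f", OF measurable_plan_util])
    then show ?thesis unfolding measurable_cong_sets[OF valid_market_val_dist(2)[OF M] refl] .
  qed
  ultimately show ?thesis by (intro integrable_const_bound)
qed

lemma admissible_mono: "S \<subseteq> S' \<Longrightarrow> admissible S p I \<Longrightarrow> admissible S' p I"
  by (induction p arbitrary: I) auto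

text \<open>Any policy for \<open>S\<close> remains available for \<open>S'\<close> and earns weakly
  more at the lower cost for every value. The maximal value bounds all expected utilities, so the
  real-valued supremum is a genuine one.\<close>

lemma opt_util_mono:
  fixes M :: "('b::finite) market"
  assumes M: "valid_market M" and M': "valid_market (M\<lparr>search_cost := c'\<rparr>)"
    and c': "c' \<le> search_cost M" and S: "S \<subseteq> S'"
  shows "opt_util M S \<le> opt_util (M\<lparr>search_cost := c'\<rparr>) S'"
  unfolding opt_util_def
proof (rule cSUP_mono)
  let ?M' = "M\<lparr>search_cost := c'\<rparr>"
  have "(\<lambda>_. Leave) \<in> policies S" by (simp add: policies_def)
  then show "policies S \<noteq> {}" by blast
  obtain vmax where vmax: "AE v in val_dist M. 0 \<le> v \<and> v \<le> vmax"
    by (rule AE_val_dist_bounded[OF M])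
  interpret prob_space "val_dist M" by (rule valid_market_val_dist[OF M])
  have "(\<integral>v. plan_util ?M' v (p v) (\<lambda>_. False) \<partial>val_dist M) \<le> vmax" if p: "p \<in> policies S'" for p
  proof -
    have "(\<integral>v. plan_util ?M' v (p v) (\<lambda>_. False) \<partial>val_dist M) \<le> (\<integral>v. vmax \<partial>val_dist M)"
    proof (rule integral_mono_AE)
      show "integrable (val_dist M) (\<lambda>v. plan_util ?M' v (p v) (\<lambda>_. False))"
        using integrable_policy[OF M' p] by simp
      show "AE v in val_dist M. plan_util ?M' v (p v) (\<lambda>_. False) \<le> vmax"
        using vmax by eventually_elim (use plan_util_le[OF M'] order_trans in blast)
    qed simp
    then show ?thesis by (simp add: prob_space)
  qed
  then show "bdd_above ((\<lambda>p. \<integral>v. plan_util ?M' v (p v) (\<lambda>_. False) \<partial>val_dist ?M') ` policies S')"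
    by (intro bdd_aboveI2[where M = vmax]) simp
  fix p assume p: "p \<in> policies S"
  then have p': "p \<in> policies S'" using admissible_mono[OF S] by (auto simp: policies_def)
  have "(\<integral>v. plan_util M v (p v) (\<lambda>_. False) \<partial>val_dist M) \<le>
      (\<integral>v. plan_util ?M' v (p v) (\<lambda>_. False) \<partial>val_dist ?M')"
    using integrable_policy[OF M p] integrable_policy[OF M' p'] plan_util_cost_antimono[OF M c']
    by (auto intro: integral_mono)
  with p' show "\<exists>p'\<in>policies S'. (\<integral>v. plan_util M v (p v) (\<lambda>_. False) \<partial>val_dist M) \<le>
      (\<integral>v. plan_util ?M' v (p' v) (\<lambda>_. False) \<partial>val_dist ?M')" by blast
qed

lemma AE_couplingD:
  assumes K: "coupling K A B"
  shows "AE x in A. P x \<Longrightarrow> AE z in K. P (fst z)" and "AE y in B. Q y \<Longrightarrow> AE z in K. Q (snd z)"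
proof -
  have m: "fst \<in> K \<rightarrow>\<^sub>M A" "snd \<in> K \<rightarrow>\<^sub>M B"
    using K by (simp_all add: coupling_def measurable_cong_sets[of K "A \<Otimes>\<^sub>M B"])
  have d: "distr K A fst = A" "distr K B snd = B" using K by (simp_all add: coupling_def)
  show "AE z in K. P (fst z)" if "AE x in A. P x"
    by (rule AE_distrD[OF m(1)]) (simp only: d that)
  show "AE z in K. Q (snd z)" if "AE y in B. Q y"
    by (rule AE_distrD[OF m(2)]) (simp only: d that)
qed

theorem theorem6p1:
  fixes M M' :: "('b::finite) market" and c' :: real
  assumes "valid_market M"
    and "valid_market M'"
    and "M' = M\<lparr>search_cost := c'\<rparr>"
    and "c' < search_cost M"
  shows "\<exists>K. coupling K (history_law M) (history_law M') \<and>
    (AE (X, X') in K. learned M X \<subseteq> learned M' X' \<and> limit_util M X \<le> limit_util M' X')"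
proof -
  note M = assms(1) and M' = assms(2) and M'_def = assms(3)
  have c': "c' \<le> search_cost M" using assms(4) by simp
  \<comment> \<open>The table is drawn from the value distribution and the true parameters, none of
    which the search cost affects; one table can therefore drive both markets.\<close>
  have "table_dist M' = table_dist M" by (simp add: table_dist_def M'_def)
  then obtain K where K: "coupling K (history_law M) (history_law M')"
    and comp: "AE (X, X') in K. \<forall>j m n. comparable (records j (past X m)) (records j (past X' n))"
    by (rule history_coupling[OF M M'])
  have "AE z in K. \<forall>n. lik M (past (fst z) n) (true_param M) \<noteq> 0"
    by (rule AE_couplingD(1)[OF K AE_lik_pos[OF M]])
  moreover have "AE z in K. \<forall>n. lik M' (past (snd z) n) (true_param M) \<noteq> 0"
    using AE_couplingD(2)[OF K AE_lik_pos[OF M']] by (simp add: true_param_def M'_def)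
  moreover have "AE z in K. \<forall>j L n0. attractive M' j L \<longrightarrow> records j (past (snd z) n0) = L \<longrightarrow>
      (\<exists>n\<ge>n0. records j (past (snd z) n) \<noteq> L)"
    by (rule AE_couplingD(2)[OF K AE_attractive_inspected_again[OF M']])
  ultimately have "AE (X, X') in K. learned M X \<subseteq> learned M' X' \<and> limit_util M X \<le> limit_util M' X'"
    using comp
  proof eventually_elim
    case (elim z)
    obtain X X' where z: "z = (X, X')" by fastforce
    have "learned M X \<subseteq> learned M' X'"
      unfolding M'_def by (rule learned_mono[OF M M'[unfolded M'_def] c']) (use elim in \<open>auto simp: z M'_def\<close>)
    moreover from this have "limit_util M X \<le> limit_util M' X'"
      unfolding limit_util_def M'_def by (rule opt_util_mono[OF M M'[unfolded M'_def] c'])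
    ultimately show ?case by (simp add: z)
  qed
  with K show ?thesis by blast
qed

end
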